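(* The number $C'(2,n)$ of colored 2-ball prime juggling patterns of period $n$ satisfies $C'(2,n)\sim\gamma_{C'}\,n\,2^n$ as $n\to\infty$, where $$\gamma_{C'}=\frac12\sum_{t=1}^\infty t\,q_t^2=\frac18\sum_{t=1}^\infty t\left(\prod_{i=2}^t\frac{i-1}{2^i-i-1}\right)^2\approx0.478326.$$
   Context: The two balls have distinct colors, orange and blue. A 2-ball colored state is an ordered pair $(x,y)$ of distinct positive integers (beats until the orange, resp. blue, ball lands). Transitions: from $(x,y)$ with $x,y\ge2$ only to $(x-1,y-1)$; from $(1,y)$ to $(z,y-1)$ for every positive integer $z\ne y-1$; from $(x,1)$ to $(x-1,z)$ for every positive integer $z\ne x-1$. A colored 2-ball prime juggling pattern of period $n$ is a directed cycle of length $n$ in this graph; two such cycles are regarded as the same pattern if one is obtained from the other by a cyclic rotation and/or by interchanging the two colors. $C'(2,n)$ is the number of such patterns. $q_t=\frac12\prod_{i=2}^t\frac{i-1}{2^i-i-1}$. *)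

theory Defs
  imports "HOL-Analysis.Analysis" "HOL-Library.Landau_Symbols" "Graph_Theory.Graph_Theory"
begin

text \<open>
  A state \<open>(x, y)\<close> records the number of beats until the orange, respectively the blue, ball lands.
\<close>

definition colored_states :: "(nat \<times> nat) set" where
  "colored_states = {(x, y). 1 \<le> x \<and> 1 \<le> y \<and> x \<noteq> y}"

inductive_set colored_transitions :: "((nat \<times> nat) \<times> (nat \<times> nat)) set" where
  fall: "x \<ge> 2 \<Longrightarrow> y \<ge> 2 \<Longrightarrow> x \<noteq> y \<Longrightarrow> ((x, y), (x - 1, y - 1)) \<in> colored_transitions"
| throw_orange: "y \<ge> 2 \<Longrightarrow> z \<ge> 1 \<Longrightarrow> z \<noteq> y - 1 \<Longrightarrow> ((1, y), (z, y - 1)) \<in> colored_transitions"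
| throw_blue: "x \<ge> 2 \<Longrightarrow> z \<ge> 1 \<Longrightarrow> z \<noteq> x - 1 \<Longrightarrow> ((x, 1), (x - 1, z)) \<in> colored_transitions"

definition colored_graph :: "(nat \<times> nat) pair_pre_digraph" where
  "colored_graph = \<lparr> pverts = colored_states, parcs = colored_transitions \<rparr>"

text \<open>
  A directed cycle is the list of its arcs (with pairwise distinct vertices), read off from some
  starting vertex; the length of the list is the period.
\<close>

definition prime_cycles :: "nat \<Rightarrow> ((nat \<times> nat) \<times> (nat \<times> nat)) list set" where
  "prime_cycles n = {p. pre_digraph.cycle (with_proj colored_graph) p \<and> length p = n}"

definition interchange_colors ::
    "((nat \<times> nat) \<times> (nat \<times> nat)) list \<Rightarrow> ((nat \<times> nat) \<times> (nat \<times> nat)) list" where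
  "interchange_colors p = map (map_prod prod.swap prod.swap) p"

definition same_pattern ::
    "nat \<Rightarrow> (((nat \<times> nat) \<times> (nat \<times> nat)) list \<times> ((nat \<times> nat) \<times> (nat \<times> nat)) list) set" where
  "same_pattern n = {(p, p'). p \<in> prime_cycles n \<and> p' \<in> prime_cycles n \<and>
     (\<exists>k. p' = rotate k p \<or> p' = interchange_colors (rotate k p))}"

definition num_colored_prime_patterns :: "nat \<Rightarrow> nat" where
  "num_colored_prime_patterns n = card (prime_cycles n // same_pattern n)"

definition juggling_q :: "nat \<Rightarrow> real" where
  "juggling_q t = 1 / 2 * (\<Prod>i = 2..t. (real i - 1) / (2 ^ i - real i - 1))"

definition gamma_C' :: real where
  "gamma_C' = 1 / 2 * (\<Sum>\<^sub>\<infinity>t\<in>{1..}. real t * (juggling_q t)\<^sup>2)"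

end

theory Submission
  imports Defs
begin

text \<open>
  Between two throws the balls just fall, so a prime cycle is determined by the cyclic sequence of its
  states in which a ball lands, each given by the color that lands and the remaining time of the other
  ball.  As long as the same color keeps landing, this time decreases; hence the cycle splits into
  \<open>2 t\<close> alternating orange and blue runs, which are finite sets of numbers, disjoint within each
  color, and the length of a run is its maximum.  If \<open>p t m\<close> is the number of sets of \<open>t\<close> disjoint
  nonempty finite sets of positive integers with maxima adding up to \<open>m\<close>, there are thus
  \<open>(t - 1)! t! p t m p t m'\<close> cycles with \<open>2 t\<close> runs of total lengths \<open>m\<close> and \<open>m'\<close>, after rooting
  them at their largest orange number.  By a linear recursion, \<open>p t m / 2 ^ m\<close> increases with \<open>m\<close> to
  the limit \<open>q t / (t - 1)!\<close>.  Summing over \<open>m + m' = n\<close> with \<open>m' < m\<close> (interchange of colors) gives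
  \<open>n / 2 * 2 ^ n * t (q t)^2\<close> asymptotically for each \<open>t\<close>; monotonicity also bounds the sum from
  above uniformly.
\<close>

section \<open>Cyclic lists\<close>

text \<open>The runs decouple because a change of color is unconditional: the thrown ball may go
  arbitrarily high, while the landing time of the other one is already fixed. So the sets of each
  color can follow one another in any order; \<open>(t - 1)! t!\<close> counts these orders, the
  orange set with the largest number being pinned to the front. The constants come from the
  recursion. If \<open>p t m\<close> behaves like \<open>L t * 2 ^ m\<close>, it turns into
  \<open>2 ^ t * L t = (t + 1) * L t + L (t - 1)\<close>, whence the denominators
  \<open>2 ^ i - i - 1\<close>; the initial \<open>1 / 2\<close> is \<open>L 1\<close>, since
  \<open>p 1 m = 2 ^ (m - 1)\<close> for positive \<open>m\<close>; and
  \<open>(t - 1)! t! (L t)^2 = t (q t)^2\<close>. The number of runs is unbounded, so limits for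
  each \<open>t\<close> alone do not suffice: the upper bound needs
  \<open>p t m \<le> L t * 2 ^ m\<close> for all \<open>m\<close>, while the lower bound may cut off
  large \<open>t\<close> and small totals. Cycles with \<open>m = m'\<close> can be paired by the
  interchange of colors; instead of analyzing them, the count is squeezed between the cycles with
  \<open>m' < m\<close> and those with \<open>m' \<le> m\<close>, which differ in at most one value
  of \<open>m'\<close>.\<close>

definition cyc_pairs :: "'a list \<Rightarrow> ('a \<times> 'a) list" where
  "cyc_pairs vs = zip (last vs # butlast vs) vs"

text \<open>A cycle is stored by the heads of its arcs; the first pair of
  \<open>cyc_pairs vs\<close> is the closing arc from \<open>last vs\<close> to
  \<open>hd vs\<close>. A single vertex thus counts as a cycle only if it has a loop.\<close>

definition is_cyc :: "('a \<Rightarrow> 'a \<Rightarrow> bool) \<Rightarrow> 'a list \<Rightarrow> bool" where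
  "is_cyc R vs \<longleftrightarrow> vs \<noteq> [] \<and> distinct vs \<and> (\<forall>(x, y) \<in> set (cyc_pairs vs). R x y)"

lemma length_cyc_pairs [simp]: "length (cyc_pairs vs) = length vs"
  by (cases vs) (auto simp: cyc_pairs_def)

lemma map_snd_cyc_pairs [simp]: "map snd (cyc_pairs vs) = vs"
  by (cases vs) (auto simp: cyc_pairs_def simp del: zip.simps zip_Cons_Cons)

lemma cyc_pairs_inject: "cyc_pairs vs = cyc_pairs ws \<longleftrightarrow> vs = ws"
  by (metis map_snd_cyc_pairs)

lemma cyc_pairs_rotate1: "cyc_pairs (rotate1 vs) = rotate1 (cyc_pairs vs)"
proof (cases vs)
  case (Cons x xs)
  have "zip (x # xs) (xs @ [x]) = zip (butlast (x # xs) @ [last (x # xs)]) (xs @ [x])"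
    by (simp only: append_butlast_last_id list.distinct not_False_eq_True)
  also have "\<dots> = zip (butlast (x # xs)) xs @ [(last (x # xs), x)]"
    by (subst zip_append) (auto simp del: butlast.simps last.simps)
  finally show ?thesis
    using Cons by (simp add: cyc_pairs_def)
qed (simp add: cyc_pairs_def)

lemma cyc_pairs_rotate: "cyc_pairs (rotate k vs) = rotate k (cyc_pairs vs)"
  by (induction k) (auto simp: cyc_pairs_rotate1)

lemma cyc_pairs_map: "cyc_pairs (map f vs) = map (map_prod f f) (cyc_pairs vs)"
proof (cases "vs = []")
  case False
  then have "last (map f vs) # butlast (map f vs) = map f (last vs # butlast vs)"
    by (simp add: last_map map_butlast)
  then show ?thesis
    unfolding cyc_pairs_def by (simp only: zip_map_map map_prod_def)
qed (simp add: cyc_pairs_def)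

lemma is_cyc_rotate [simp]: "is_cyc R (rotate k vs) = is_cyc R vs"
  by (auto simp: is_cyc_def cyc_pairs_rotate)

lemma successively_zip:
  "successively R (x # vs) \<longleftrightarrow> (\<forall>(x, y) \<in> set (zip (x # butlast vs) vs). R x y)"
  by (induction vs arbitrary: x) auto

text \<open>A copy of the last vertex in front opens the cycle up into a path, the form on which
  inductions run.\<close>

lemma is_cyc_successively:
  "is_cyc R vs \<longleftrightarrow> vs \<noteq> [] \<and> distinct vs \<and> successively R (last vs # vs)"
  unfolding is_cyc_def successively_zip cyc_pairs_def ..

lemma ex_rotate_last:
  assumes "x \<in> set vs"
  shows "\<exists>k. rotate k vs \<noteq> [] \<and> last (rotate k vs) = x"
proof -
  obtain as bs where "vs = as @ x # bs"
    using assms by (auto simp: in_set_conv_decomp)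
  then have "rotate (Suc (length as)) vs = bs @ as @ [x]"
    by (metis append.assoc append_Cons append_Nil rotate_append length_append_singleton)
  then show ?thesis
    by (intro exI[of _ "Suc (length as)"]) simp
qed

lemma ex_rotate_hd:
  assumes "x \<in> set vs"
  shows "\<exists>k. rotate k vs \<noteq> [] \<and> hd (rotate k vs) = x"
proof -
  obtain as bs where "vs = as @ x # bs"
    using assms by (auto simp: in_set_conv_decomp)
  then have "rotate (length as) vs = x # bs @ as"
    by (simp add: rotate_append)
  then show ?thesis
    by (intro exI[of _ "length as"]) simp
qed

lemma rotate_eq_of_hd_eq:
  assumes "distinct vs" "hd (rotate k vs) = hd vs"
  shows "rotate k vs = vs"
proof (cases "vs = []")
  case False
  have "hd (rotate k vs) = vs ! (k mod length vs)"
    using False by (simp add: hd_rotate_conv_nth)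
  then have "k mod length vs = 0"
    using assms False by (metis hd_conv_nth length_greater_0_conv mod_less_divisor nth_eq_iff_index_eq)
  then show ?thesis
    by (metis rotate_conv_mod rotate0 id_apply)
qed auto

text \<open>The shift \<open>j\<close> counts only the retained entries that have moved to the end.
  This later turns a rotation of states into a rotation of landing states.\<close>

lemma filter_rotate: "\<exists>j. filter P (rotate k vs) = rotate j (filter P vs)"
proof (induction k)
  case (Suc k)
  then obtain j where j: "filter P (rotate k vs) = rotate j (filter P vs)"
    by blast
  show ?case
  proof (cases "rotate k vs")
    case (Cons x xs)
    show ?thesis
    proof (cases "P x")
      case True
      then have "filter P (rotate (Suc k) vs) = rotate1 (filter P (rotate k vs))"
        using Cons by simp
      then show ?thesis
        using j by (metis rotate_Suc)
    next
      case False
      then have "filter P (rotate (Suc k) vs) = filter P (rotate k vs)"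
        using Cons by simp
      then show ?thesis
        using j by metis
    qed
  qed (use j in auto)
qed (auto intro: exI[of _ 0])

lemma rotate_inverse: "\<exists>j. rotate j (rotate k vs) = vs"
proof (cases "vs = []")
  case False
  define m where "m = length vs"
  have "m > 0"
    using False by (simp add: m_def)
  have "(m - k mod m + k) mod m = 0"
  proof -
    have "k mod m < m" "k div m * m + k mod m = k"
      using \<open>m > 0\<close> by auto
    then have "m - k mod m + k = m + k div m * m"
      by linarith
    then show ?thesis by simp
  qed
  then have "rotate (m - k mod m) (rotate k vs) = vs"
    unfolding rotate_rotate by (metis rotate_conv_mod rotate0 id_apply m_def)
  then show ?thesis ..
qed auto

lemma is_cyc_successor:
  assumes "is_cyc R vs" "x \<in> set vs"
  shows "\<exists>y \<in> set vs. R x y"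
proof -
  obtain k where k: "rotate k vs \<noteq> []" "last (rotate k vs) = x"
    using ex_rotate_last[OF assms(2)] by blast
  then have "(x, hd (rotate k vs)) \<in> set (cyc_pairs (rotate k vs))"
    by (cases "rotate k vs") (auto simp: cyc_pairs_def)
  then have "R x (hd (rotate k vs))"
    using assms(1) by (auto simp: is_cyc_def cyc_pairs_rotate)
  moreover have "hd (rotate k vs) \<in> set vs"
    using k(1) by (metis list.set_sel(1) set_rotate)
  ultimately show ?thesis
    by blast
qed

section \<open>Prime cycles as cyclic lists of states\<close>

abbreviation step :: "nat \<times> nat \<Rightarrow> nat \<times> nat \<Rightarrow> bool" where
  "step s t \<equiv> (s, t) \<in> colored_transitions"

lemma transitions_states:
  assumes "step s t"
  shows "s \<in> colored_states" "t \<in> colored_states"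
proof -
  from assms have "s \<in> colored_states \<and> t \<in> colored_states"
    by (cases s; cases t) (auto simp: colored_states_def elim!: colored_transitions.cases)
  then show "s \<in> colored_states" "t \<in> colored_states"
    by simp_all
qed

lemma pcas_iff:
  "p \<noteq> [] \<Longrightarrow> pcas u p v \<longleftrightarrow> p = zip (u # butlast (map snd p)) (map snd p) \<and> snd (last p) = v"
proof (induction p arbitrary: u)
  case (Cons e p)
  then show ?case
    by (cases "p = []"; cases e) auto
qed simp

lemma pawalk_verts_pcas: "pcas u p v \<Longrightarrow> pawalk_verts u p = u # map snd p"
  by (induction p arbitrary: u) auto

text \<open>The closed walk starts at its last head, so the heads alone determine the arcs, and the
  distinctness demanded of a cycle is that of the heads.\<close>

lemma prime_cycles_iff:
  "p \<in> prime_cycles n \<longleftrightarrow> (\<exists>vs. p = cyc_pairs vs \<and> is_cyc step vs \<and> length vs = n)"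
proof -
  have c: "pre_digraph.cycle (with_proj colored_graph) p \<longleftrightarrow>
    (\<exists>u. u \<in> colored_states \<and> set p \<subseteq> colored_transitions \<and> pcas u p u \<and> distinct (map snd p) \<and> p \<noteq> [])"
    unfolding pre_digraph.cycle_def pre_digraph.awalk_def cas_with_proj_eq awalk_verts_with_proj_eq
    by (intro ex_cong1) (auto simp: colored_graph_def pawalk_verts_pcas)
  show ?thesis
  proof
    assume "p \<in> prime_cycles n"
    then obtain u where u: "set p \<subseteq> colored_transitions" "pcas u p u" "distinct (map snd p)"
        "p \<noteq> []" "length p = n"
      unfolding prime_cycles_def mem_Collect_eq c by blast
    have "p = cyc_pairs (map snd p)"
      using u pcas_iff[of p u u] by (auto simp: cyc_pairs_def last_map)
    then show "\<exists>vs. p = cyc_pairs vs \<and> is_cyc step vs \<and> length vs = n"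
      using u by (intro exI[of _ "map snd p"]) (auto simp: is_cyc_def)
  next
    assume "\<exists>vs. p = cyc_pairs vs \<and> is_cyc step vs \<and> length vs = n"
    then obtain vs where vs: "p = cyc_pairs vs" "is_cyc step vs" "length vs = n"
      by blast
    have sp: "map snd p = vs" "p \<noteq> []"
      using vs unfolding is_cyc_def by (simp, metis length_cyc_pairs length_0_conv)
    have lp: "snd (last p) = last vs"
      using sp by (metis last_map)
    have "p = zip (last vs # butlast (map snd p)) (map snd p)"
      unfolding sp(1) using vs(1) by (simp only: cyc_pairs_def)
    then have "pcas (last vs) p (last vs)"
      using lp pcas_iff[OF sp(2)] by blast
    moreover have "set p \<subseteq> colored_transitions"
      using vs by (auto simp: is_cyc_def)
    moreover have "last vs \<in> colored_states"
    proof -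
      have "last p \<in> colored_transitions"
        using \<open>set p \<subseteq> _\<close> sp(2) by auto
      then show ?thesis
        using lp by (metis prod.collapse transitions_states(2))
    qed
    ultimately have "\<exists>u. u \<in> colored_states \<and> set p \<subseteq> colored_transitions \<and> pcas u p u \<and>
        distinct (map snd p) \<and> p \<noteq> []"
      using sp vs(2) unfolding is_cyc_def by blast
    moreover have "length p = n"
      using vs by simp
    ultimately show "p \<in> prime_cycles n"
      unfolding prime_cycles_def mem_Collect_eq c by blast
  qed
qed

section \<open>Landing states and ladders\<close>

text \<open>
  A node \<open>(c, e)\<close> stands for a state in which a ball lands on the next beat and the other one
  \<open>Suc e\<close> beats later; \<open>c\<close> tells whether the landing ball is the orange one.  Every state is
  \<open>ladder b j\<close> for exactly one node \<open>b\<close>, the one it falls to after \<open>j\<close> beats.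
\<close>

fun ladder :: "bool \<times> nat \<Rightarrow> nat \<Rightarrow> nat \<times> nat" where
  "ladder (c, e) j = (if c then (Suc j, Suc (Suc (e + j))) else (Suc (Suc (e + j)), Suc j))"

text \<open>After a throw from \<open>(c, d)\<close> the other ball is \<open>Suc d\<close> beats
  away from landing. Either the thrown ball comes down first, which leaves the other one a smaller
  delay \<open>e < d\<close>, or the other ball does, and then the height of the throw makes
  \<open>e\<close> arbitrary.\<close>

fun edge :: "bool \<times> nat \<Rightarrow> bool \<times> nat \<Rightarrow> bool" where
  "edge (c, d) (c', e) \<longleftrightarrow> c \<noteq> c' \<or> e < d"

text \<open>Beats between consecutive landing states. A change of color takes \<open>Suc d\<close>
  beats whatever \<open>e\<close> is, since the landing ball was already in the air.\<close>

fun cost :: "bool \<times> nat \<Rightarrow> bool \<times> nat \<Rightarrow> nat" where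
  "cost (c, d) (c', e) = (if c = c' then d - e else Suc d)"

lemma ladder_inject: "ladder a i = ladder b j \<longleftrightarrow> a = b \<and> i = j"
  by (cases a; cases b) auto

declare ladder.simps [simp del]

lemma ladder_exhaust:
  assumes "s \<in> colored_states"
  obtains b j where "s = ladder b j"
proof (cases s)
  case (Pair x y)
  show thesis
  proof (cases "x < y")
    case True
    then show thesis
      using assms Pair that[of "(True, y - x - 1)" "x - 1"] by (auto simp: colored_states_def ladder.simps)
  next
    case False
    then show thesis
      using assms Pair that[of "(False, x - y - 1)" "y - 1"] by (auto simp: colored_states_def ladder.simps)
  qed
qed

text \<open>Requiring both ends to be states absorbs the side conditions on the height
  \<open>z\<close> of a throw, so that what remains is plain arithmetic.\<close>

lemma step_iff: "step s t \<longleftrightarrow>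
  s \<in> colored_states \<and> t \<in> colored_states \<and>
  (fst s \<ge> 2 \<and> snd s \<ge> 2 \<and> t = (fst s - 1, snd s - 1) \<or>
   fst s = 1 \<and> snd t = snd s - 1 \<or> snd s = 1 \<and> fst t = fst s - 1)"
  (is "?L \<longleftrightarrow> ?R")
proof
  assume L: ?L
  then have "fst s \<ge> 2 \<and> snd s \<ge> 2 \<and> t = (fst s - 1, snd s - 1) \<or>
   fst s = 1 \<and> snd t = snd s - 1 \<or> snd s = 1 \<and> fst t = fst s - 1"
    by (cases s; cases t) (auto elim!: colored_transitions.cases)
  with transitions_states[OF L] show ?R
    by blast
next
  assume R: ?R
  obtain x y x' y' where st: "s = (x, y)" "t = (x', y')"
    by fastforce
  from R consider "x \<ge> 2" "y \<ge> 2" "x \<noteq> y" "x' = x - 1" "y' = y - 1"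
    | "x = 1" "y \<ge> 2" "x' \<ge> 1" "x' \<noteq> y - 1" "y' = y - 1"
    | "y = 1" "x \<ge> 2" "y' \<ge> 1" "y' \<noteq> x - 1" "x' = x - 1"
    unfolding st colored_states_def by (simp, linarith)
  then show ?L
    unfolding st by cases (simp_all add: colored_transitions.intros del: One_nat_def)
qed

text \<open>Off the landing states a step goes one rung down the same ladder. A throw enters the
  ladder of the next node at rung \<open>cost a b - 1\<close>, so that its landing state is reached
  after exactly \<open>cost a b\<close> beats.\<close>

lemma step_ladder:
  "step (ladder a i) (ladder b j) \<longleftrightarrow> a = b \<and> i = Suc j \<or> i = 0 \<and> edge a b \<and> Suc j = cost a b"
proof -
  obtain c d c' e where ab: "a = (c, d)" "b = (c', e)"
    by fastforce
  show ?thesis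
    unfolding ab step_iff ladder.simps colored_states_def by (cases c; cases c') auto
qed

text \<open>The landing state of the start \<open>a\<close> is left out; each node contributes a
  descending block that ends in its own landing state.\<close>

fun walk :: "bool \<times> nat \<Rightarrow> (bool \<times> nat) list \<Rightarrow> (nat \<times> nat) list" where
  "walk a [] = []"
| "walk a (b # bs) = map (ladder b) (rev [0..<cost a b]) @ walk b bs"

definition states_of :: "(bool \<times> nat) list \<Rightarrow> (nat \<times> nat) list" where
  "states_of bs = walk (last bs) bs"

lemma edge_cost: "edge a b \<Longrightarrow> cost a b > 0"
  by (cases a; cases b) auto

lemma walk_append: "walk a (bs @ cs) = walk a bs @ walk (last (a # bs)) cs"
  by (induction a bs rule: walk.induct) auto

text \<open>The induction needs a start at an arbitrary rung \<open>j\<close>: the rest of the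
  current ladder comes first, and whole blocks follow.\<close>

lemma walk_decode:
  assumes "successively step (ladder b j # vs)" "last (ladder b j # vs) = ladder c 0"
  shows "\<exists>bs. vs = map (ladder b) (rev [0..<j]) @ walk b bs \<and> successively edge (b # bs)
    \<and> last (b # bs) = c"
  using assms
proof (induction vs arbitrary: b j)
  case Nil
  then show ?case
    by (intro exI[of _ "[]"]) (auto simp: ladder_inject)
next
  case (Cons t vs)
  then have st: "step (ladder b j) t"
    by simp
  obtain b' j' where t: "t = ladder b' j'"
    using ladder_exhaust transitions_states(2)[OF st] by blast
  obtain bs where bs: "vs = map (ladder b') (rev [0..<j']) @ walk b' bs" "successively edge (b' # bs)"
      "last (b' # bs) = c"
    using Cons.IH[of b' j'] Cons.prems t by auto
  from st t consider "b = b'" "j = Suc j'" | "j = 0" "edge b b'" "Suc j' = cost b b'"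
    by (auto simp: step_ladder)
  then show ?case
  proof cases
    case 1
    then show ?thesis
      using bs t by (intro exI[of _ bs]) auto
  next
    case 2
    have "t # vs = walk b (b' # bs)"
      using bs(1) t by (simp flip: 2(3))
    then show ?thesis
      using bs 2 by (intro exI[of _ "b' # bs"]) auto
  qed
qed

lemma successively_ladder:
  "successively step (map (ladder b) (rev [0..<Suc j]))"
  by (induction j) (auto simp: step_ladder successively_Cons)

text \<open>Each block is nonempty because an edge has positive cost, and it contains exactly one
  landing state; hence the filter recovers the nodes in order.\<close>

lemma walk_props:
  assumes "successively edge (a # bs)"
  shows "successively step (ladder a 0 # walk a bs)"
    "last (ladder a 0 # walk a bs) = ladder (last (a # bs)) 0"
    "filter (\<lambda>s. \<exists>b. s = ladder b 0) (walk a bs) = map (\<lambda>b. ladder b 0) bs"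
proof -
  have "successively step (ladder a 0 # walk a bs) \<and>
    last (ladder a 0 # walk a bs) = ladder (last (a # bs)) 0 \<and>
    filter (\<lambda>s. \<exists>b. s = ladder b 0) (walk a bs) = map (\<lambda>b. ladder b 0) bs"
    using assms
  proof (induction bs arbitrary: a)
    case (Cons b bs)
    then have e: "edge a b"
      by simp
    then obtain j where j: "cost a b = Suc j"
      using edge_cost gr0_implies_Suc by blast
    have l: "last (map (ladder b) (rev [0..<Suc j])) = ladder b 0"
      by (simp add: last_map last_rev del: upt_Suc)
    have f: "filter (\<lambda>s. \<exists>b. s = ladder b 0) (map (ladder b) (rev [0..<Suc j])) = [ladder b 0]"
      by (induction j) (auto simp: ladder_inject)
    have IH: "successively step (ladder b 0 # walk b bs)"
      "last (ladder b 0 # walk b bs) = ladder (last (b # bs)) 0"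
      "filter (\<lambda>s. \<exists>b. s = ladder b 0) (walk b bs) = map (\<lambda>b. ladder b 0) bs"
      using Cons by auto
    have w: "walk a (b # bs) = map (ladder b) (rev [0..<Suc j]) @ walk b bs"
      using j by simp
    have "successively step (walk a (b # bs))"
      unfolding w successively_append_iff
      using successively_ladder[of b j] IH(1) l by (auto simp: successively_Cons simp del: upt_Suc)
    moreover have "step (ladder a 0) (ladder b j)"
      using e j by (simp add: step_ladder)
    ultimately have "successively step (ladder a 0 # walk a (b # bs))"
      using j by (simp add: successively_Cons)
    moreover have "last (ladder a 0 # walk a (b # bs)) = ladder (last (a # b # bs)) 0"
      unfolding w using IH(2) l by (auto simp: last_append simp del: upt_Suc split: if_splits)
    moreover have "filter (\<lambda>s. \<exists>b. s = ladder b 0) (walk a (b # bs)) = map (\<lambda>b. ladder b 0) (b # bs)"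
      unfolding w filter_append f IH(3) by simp
    ultimately show ?case
      by blast
  qed auto
  then show "successively step (ladder a 0 # walk a bs)"
    "last (ladder a 0 # walk a bs) = ladder (last (a # bs)) 0"
    "filter (\<lambda>s. \<exists>b. s = ladder b 0) (walk a bs) = map (\<lambda>b. ladder b 0) bs"
    by blast+
qed

lemma set_walk: "set (walk a bs) \<subseteq> (\<Union>b\<in>set bs. range (ladder b))"
  by (induction a bs rule: walk.induct) auto

lemma distinct_walk: "distinct bs \<Longrightarrow> distinct (walk a bs)"
proof (induction a bs rule: walk.induct)
  case (2 a b bs)
  then show ?case
    using set_walk[of b bs] by (auto simp: distinct_map inj_on_def ladder_inject)
qed simp

lemma states_of_cyc:
  assumes "is_cyc edge bs"
  shows "is_cyc step (states_of bs)" "last (states_of bs) = ladder (last bs) 0"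
    "filter (\<lambda>s. \<exists>b. s = ladder b 0) (states_of bs) = map (\<lambda>b. ladder b 0) bs"
proof -
  have bs: "bs \<noteq> []" "distinct bs" "successively edge (last bs # bs)"
    using assms by (auto simp: is_cyc_successively)
  note w = walk_props[OF bs(3)]
  show f: "filter (\<lambda>s. \<exists>b. s = ladder b 0) (states_of bs) = map (\<lambda>b. ladder b 0) bs"
    using w(3) by (simp add: states_of_def)
  then have "states_of bs \<noteq> []"
    using bs(1) by (metis filter.simps(1) map_is_Nil_conv)
  then show l: "last (states_of bs) = ladder (last bs) 0"
    using w(2) bs by (simp add: states_of_def)
  show "is_cyc step (states_of bs)"
    unfolding is_cyc_successively l using \<open>states_of bs \<noteq> []\<close> w(1) distinct_walk[OF bs(2)]
    by (auto simp: states_of_def)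
qed

text \<open>Cutting the cycle right behind a landing state leaves whole blocks only. The nodes are
  distinct because their landing states are.\<close>

lemma states_of_decode:
  assumes "is_cyc step vs" "last vs = ladder a 0"
  shows "\<exists>bs. is_cyc edge bs \<and> vs = states_of bs"
proof -
  have vs: "vs \<noteq> []" "distinct vs" "successively step (ladder a 0 # vs)"
    using assms by (auto simp: is_cyc_successively)
  obtain bs where bs: "vs = walk a bs" "successively edge (a # bs)" "last (a # bs) = a"
    using walk_decode[OF vs(3), of a] vs(1) assms(2) by auto
  have "bs \<noteq> []"
    using vs(1) bs(1) by auto
  have "distinct (map (\<lambda>b. ladder b 0) bs)"
    using walk_props(3)[OF bs(2)] vs(2) bs(1) by (metis distinct_filter)
  then have "distinct bs"
    by (simp add: distinct_map)
  then show ?thesis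
    using bs \<open>bs \<noteq> []\<close> by (intro exI[of _ bs]) (auto simp: is_cyc_successively states_of_def)
qed

text \<open>Moving one node to the end moves its whole block, whose length does not change because
  the cyclic predecessor of the node stays the same.\<close>

lemma states_of_rotate: "\<exists>j. states_of (rotate k bs) = rotate j (states_of bs)"
proof -
  have 1: "\<exists>j. states_of (rotate1 bs) = rotate j (states_of bs)" for bs
  proof (cases bs)
    case Nil
    then show ?thesis by (auto simp: states_of_def)
  next
    case (Cons b cs)
    define l where "l = map (ladder b) (rev [0..<cost (last bs) b])"
    have "states_of bs = l @ walk b cs"
      by (simp add: states_of_def l_def Cons)
    moreover have "states_of (rotate1 bs) = walk b cs @ l"
      by (simp add: states_of_def l_def Cons walk_append)
    ultimately show ?thesis
      by (metis rotate_append)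
  qed
  show ?thesis
  proof (induction k)
    case (Suc k)
    then show ?case
      using 1[of "rotate k bs"] by (auto simp: rotate_rotate)
  qed (auto intro: exI[of _ 0])
qed

section \<open>Interchange of colors on nodes\<close>

definition swap_node :: "bool \<times> nat \<Rightarrow> bool \<times> nat" where
  "swap_node = map_prod Not id"

lemma swap_ladder: "prod.swap (ladder b j) = ladder (swap_node b) j"
  by (cases b) (auto simp: swap_node_def ladder.simps)

lemma cost_swap [simp]: "cost (swap_node a) (swap_node b) = cost a b"
  by (cases a; cases b) (auto simp: swap_node_def)

lemma edge_swap [simp]: "edge (swap_node a) (swap_node b) = edge a b"
  by (cases a; cases b) (auto simp: swap_node_def)

lemma inj_swap_node: "inj swap_node"
  by (auto simp: swap_node_def inj_def)

lemma walk_swap: "walk (swap_node a) (map swap_node bs) = map prod.swap (walk a bs)"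
  by (induction a bs rule: walk.induct) (auto simp: swap_ladder)

lemma states_of_swap: "states_of (map swap_node bs) = map prod.swap (states_of bs)"
  by (cases "bs = []") (auto simp: states_of_def last_map walk_swap)

lemma is_cyc_edge_swap [simp]: "is_cyc edge (map swap_node bs) = is_cyc edge bs"
  unfolding is_cyc_def cyc_pairs_map
  by (simp add: distinct_map inj_on_subset[OF inj_swap_node] case_prod_unfold)

text \<open>Off the landing states every step lowers both coordinates, so a state with least first
  coordinate would have a successor below it.\<close>

lemma cyc_has_landing:
  assumes "is_cyc step vs"
  shows "\<exists>b. ladder b 0 \<in> set vs"
proof (rule ccontr)
  assume no: "\<nexists>b. ladder b 0 \<in> set vs"
  have "vs \<noteq> []"
    using assms by (simp add: is_cyc_def)
  then obtain s where s: "s \<in> set vs" "\<And>t. t \<in> set vs \<Longrightarrow> fst s \<le> fst t"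
    using arg_min_if_finite[of "set vs" fst] by (metis List.finite_set leI set_empty)
  obtain t where t: "t \<in> set vs" "step s t"
    using is_cyc_successor[OF assms s(1)] by blast
  obtain a i b j where l: "s = ladder a i" "t = ladder b j"
    using t(2) transitions_states[OF t(2)] by (metis ladder_exhaust)
  have "i \<noteq> 0"
    using no s(1) l by metis
  then have "a = b" "i = Suc j"
    using t(2) l by (auto simp: step_ladder)
  then have "fst t < fst s"
    using l by (cases a) (auto simp: ladder.simps)
  then show False
    using s(2)[OF t(1)] by simp
qed

section \<open>Cyclic lists of nodes\<close>

text \<open>The beats between two landings are charged to the ball that has just been thrown. In
  this way a run is charged its own maximum, including the beats of the color change behind
  it.\<close>

definition run_time :: "bool \<Rightarrow> (bool \<times> nat) list \<Rightarrow> nat" where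
  "run_time c bs = sum_list (map (\<lambda>(x, y). if fst x = c then cost x y else 0) (cyc_pairs bs))"

lemma run_time_rotate [simp]: "run_time c (rotate k bs) = run_time c bs"
proof -
  have "sum_list (rotate1 xs) = sum_list xs" for xs :: "nat list"
    by (cases xs) auto
  then have "sum_list (rotate k xs) = sum_list xs" for xs :: "nat list"
    by (induction k) auto
  then show ?thesis
    by (simp add: run_time_def cyc_pairs_rotate flip: rotate_map)
qed

lemma run_time_swap: "run_time c (map swap_node bs) = run_time (\<not> c) bs"
proof -
  have "(\<lambda>(x, y). if fst x = c then cost x y else 0) \<circ> map_prod swap_node swap_node
      = (\<lambda>(x, y). if fst x = (\<not> c) then cost x y else 0)"
    by (rule ext) (auto simp: swap_node_def split: prod.splits)
  then show ?thesis
    by (simp add: run_time_def cyc_pairs_map)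
qed

lemma length_walk:
  "length (walk a bs) = sum_list (map (\<lambda>(x, y). cost x y) (zip (a # butlast bs) bs))"
  by (induction a bs rule: walk.induct) auto

lemma length_states_of: "length (states_of bs) = run_time True bs + run_time False bs"
proof -
  have "length (states_of bs) = sum_list (map (\<lambda>(x, y). cost x y) (cyc_pairs bs))"
    by (simp add: states_of_def length_walk cyc_pairs_def)
  also have "\<dots> = run_time True bs + run_time False bs"
    unfolding run_time_def sum_list_addf[symmetric]
    by (intro arg_cong[where f = sum_list] map_cong) auto
  finally show ?thesis .
qed

text \<open>Within one color the number strictly decreases along edges, so a node with the least
  number would have no successor.\<close>

lemma both_colors:
  assumes "is_cyc edge bs"
  shows "\<exists>d. (c, d) \<in> set bs"
proof (rule ccontr)
  assume no: "\<nexists>d. (c, d) \<in> set bs"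
  have "bs \<noteq> []"
    using assms by (simp add: is_cyc_def)
  then obtain x where x: "x \<in> set bs" "\<And>y. y \<in> set bs \<Longrightarrow> snd x \<le> snd y"
    using arg_min_if_finite[of "set bs" snd] by (metis List.finite_set leI set_empty)
  obtain y where y: "y \<in> set bs" "edge x y"
    using is_cyc_successor[OF assms x(1)] by blast
  have "fst z \<noteq> c" if "z \<in> set bs" for z
  proof
    assume "fst z = c"
    then have "(c, snd z) \<in> set bs"
      using that by (simp flip: \<open>fst z = c\<close>)
    then show False
      using no by blast
  qed
  then have "fst x = fst y"
    using x(1) y(1) by blast
  then have "snd y < snd x"
    using y(2) by (cases x; cases y) auto
  then show False
    using x(2)[OF y(1)] by simp
qed

text \<open>Fixing the root at the largest orange node selects one of the rotations.\<close>

definition rooted :: "(bool \<times> nat) list \<Rightarrow> bool" where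
  "rooted bs \<longleftrightarrow> is_cyc edge bs \<and> fst (hd bs) \<and> (\<forall>d. (True, d) \<in> set bs \<longrightarrow> d \<le> snd (hd bs))"

lemma ex_rooted:
  assumes "is_cyc edge bs"
  shows "\<exists>k. rooted (rotate k bs)"
proof -
  define S where "S = {d. (True, d) \<in> set bs}"
  have "S = snd ` (set bs \<inter> {x. fst x})"
    by (force simp: S_def)
  then have S: "finite S" "S \<noteq> {}"
    using both_colors[OF assms, of True] by (auto simp: S_def)
  then have "(True, Max S) \<in> set bs"
    using Max_in[of S] by (auto simp: S_def)
  then obtain k where k: "rotate k bs \<noteq> []" "hd (rotate k bs) = (True, Max S)"
    using ex_rotate_hd by metis
  moreover have "d \<le> Max S" if "(True, d) \<in> set bs" for d
    using S that by (intro Max_ge) (auto simp: S_def)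
  ultimately have "rooted (rotate k bs)"
    using assms by (auto simp: rooted_def)
  then show ?thesis ..
qed

text \<open>An orange predecessor of the root would carry a larger number. Hence the root starts an
  orange run, and no run is cut in two.\<close>

lemma rooted_last:
  assumes "rooted bs"
  shows "\<not> fst (last bs)"
proof
  assume l: "fst (last bs)"
  have bs: "bs \<noteq> []"
    using assms by (auto simp: rooted_def is_cyc_def)
  then have "(last bs, hd bs) \<in> set (cyc_pairs bs)"
    by (cases bs) (auto simp: cyc_pairs_def)
  then have "edge (last bs) (hd bs)"
    using assms by (auto simp: rooted_def is_cyc_def)
  then have "snd (hd bs) < snd (last bs)"
    using l assms by (cases "last bs"; cases "hd bs") (auto simp: rooted_def)
  moreover have "last bs = (True, snd (last bs))"
    using l by (metis prod.collapse)
  then have "snd (last bs) \<le> snd (hd bs)"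
    using assms bs last_in_set[OF bs] by (metis rooted_def)
  ultimately show False
    by simp
qed

text \<open>The root is determined by the set of nodes, which a rotation preserves; as the nodes are
  distinct, the first one fixes the rotation.\<close>

lemma rooted_rotate_eq:
  assumes "rooted bs" "rooted (rotate k bs)"
  shows "rotate k bs = bs"
proof -
  have *: "hd cs = (True, Max {d. (True, d) \<in> set cs})" if "rooted cs" for cs
  proof -
    have "cs \<noteq> []"
      using that by (auto simp: rooted_def is_cyc_def)
    then have h: "(True, snd (hd cs)) \<in> set cs"
      using that by (metis hd_in_set prod.collapse rooted_def)
    have "{d. (True, d) \<in> set cs} = snd ` (set cs \<inter> {x. fst x})"
      by force
    then have "Max {d. (True, d) \<in> set cs} = snd (hd cs)"
      using h that by (intro Max_eqI) (auto simp: rooted_def)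
    then show ?thesis
      using that by (simp add: rooted_def prod_eq_iff)
  qed
  have "hd (rotate k bs) = hd bs"
    using *[OF assms(1)] *[OF assms(2)] by simp
  then show ?thesis
    using assms(1) by (intro rotate_eq_of_hd_eq) (auto simp: rooted_def is_cyc_def)
qed

section \<open>Patterns\<close>

lemma interchange_cyc_pairs: "interchange_colors (cyc_pairs vs) = cyc_pairs (map prod.swap vs)"
  by (simp add: interchange_colors_def cyc_pairs_map)

lemma interchange_rotate: "interchange_colors (rotate k p) = rotate k (interchange_colors p)"
  by (simp add: interchange_colors_def rotate_map)

lemma interchange_involution [simp]: "interchange_colors (interchange_colors p) = p"
  by (simp add: interchange_colors_def prod.map_comp comp_def)

text \<open>The interchange is an involution commuting with rotations, so inverses and composites
  keep one of the two forms.\<close>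

lemma equiv_same_pattern: "equiv (prime_cycles n) (same_pattern n)"
proof (rule equivI)
  show "refl_on (prime_cycles n) (same_pattern n)"
    by (intro refl_onI) (auto simp: same_pattern_def intro: exI[of _ 0])
  show "same_pattern n \<subseteq> prime_cycles n \<times> prime_cycles n"
    by (auto simp: same_pattern_def)
  show "sym (same_pattern n)"
  proof (rule symI)
    fix p p' assume "(p, p') \<in> same_pattern n"
    then obtain k where k: "p \<in> prime_cycles n" "p' \<in> prime_cycles n"
      "p' = rotate k p \<or> p' = interchange_colors (rotate k p)"
      by (auto simp: same_pattern_def)
    obtain j where j: "rotate j (rotate k p) = p"
      using rotate_inverse by blast
    have "p = rotate j p' \<or> p = interchange_colors (rotate j p')"
      using k(3) j by (metis interchange_involution interchange_rotate)
    then show "(p', p) \<in> same_pattern n"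
      using k by (auto simp: same_pattern_def)
  qed
  show "trans (same_pattern n)"
  proof (rule transI)
    fix p p' p'' assume "(p, p') \<in> same_pattern n" "(p', p'') \<in> same_pattern n"
    then obtain k l where k: "p \<in> prime_cycles n" "p'' \<in> prime_cycles n"
      "p' = rotate k p \<or> p' = interchange_colors (rotate k p)"
      "p'' = rotate l p' \<or> p'' = interchange_colors (rotate l p')"
      by (auto simp: same_pattern_def)
    have "p'' = rotate (l + k) p \<or> p'' = interchange_colors (rotate (l + k) p)"
      using k(3,4) by (metis interchange_involution interchange_rotate rotate_rotate)
    then show "(p, p'') \<in> same_pattern n"
      using k(1,2) by (auto simp: same_pattern_def)
  qed
qed

definition pattern_of :: "(bool \<times> nat) list \<Rightarrow> ((nat \<times> nat) \<times> (nat \<times> nat)) list" where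
  "pattern_of bs = cyc_pairs (states_of bs)"

lemma pattern_of_prime:
  assumes "is_cyc edge bs"
  shows "pattern_of bs \<in> prime_cycles (run_time True bs + run_time False bs)"
  unfolding prime_cycles_iff pattern_of_def
  using states_of_cyc(1)[OF assms] length_states_of by metis

lemma pattern_of_swap: "pattern_of (map swap_node bs) = interchange_colors (pattern_of bs)"
  by (simp add: pattern_of_def states_of_swap interchange_cyc_pairs)

lemma pattern_of_rotate: "\<exists>j. pattern_of (rotate k bs) = rotate j (pattern_of bs)"
  unfolding pattern_of_def using states_of_rotate cyc_pairs_rotate by metis

text \<open>Filtering the landing states on both sides recovers the nodes, up to a rotation.\<close>

lemma pattern_of_rotate_imp:
  assumes "is_cyc edge bs" "is_cyc edge cs" "pattern_of cs = rotate k (pattern_of bs)"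
  shows "\<exists>j. cs = rotate j bs"
proof -
  let ?P = "\<lambda>s. \<exists>b. s = ladder b 0"
  have "states_of cs = rotate k (states_of bs)"
    using assms(3) by (simp add: pattern_of_def flip: cyc_pairs_rotate) (simp add: cyc_pairs_inject)
  then obtain j where "filter ?P (states_of cs) = rotate j (filter ?P (states_of bs))"
    using filter_rotate by metis
  then have "map (\<lambda>b. ladder b 0) cs = map (\<lambda>b. ladder b 0) (rotate j bs)"
    unfolding states_of_cyc(3)[OF assms(1)] states_of_cyc(3)[OF assms(2)] by (simp add: rotate_map)
  then have "cs = rotate j bs"
    by (rule map_injective) (auto simp: inj_def ladder_inject)
  then show ?thesis ..
qed

definition rooted_cycles :: "(nat \<Rightarrow> nat \<Rightarrow> bool) \<Rightarrow> nat \<Rightarrow> (bool \<times> nat) list set" where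
  "rooted_cycles R n = {bs. rooted bs \<and> run_time True bs + run_time False bs = n
     \<and> R (run_time False bs) (run_time True bs)}"

text \<open>A rotation that ends in a landing state can be decoded into nodes. The colors are
  interchanged if the blue total is the larger one, and a further rotation moves the root to the
  front.\<close>

lemma prime_cycle_rooted:
  assumes "p \<in> prime_cycles n"
  shows "\<exists>bs \<in> rooted_cycles (\<le>) n. (p, pattern_of bs) \<in> same_pattern n"
proof -
  obtain vs where vs: "p = cyc_pairs vs" "is_cyc step vs"
    using assms by (auto simp: prime_cycles_iff)
  obtain b where "ladder b 0 \<in> set vs"
    using cyc_has_landing[OF vs(2)] by blast
  then obtain k where "rotate k vs \<noteq> []" "last (rotate k vs) = ladder b 0"
    using ex_rotate_last by metis
  then obtain bs where bs: "is_cyc edge bs" "rotate k vs = states_of bs"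
    using states_of_decode vs(2) by (metis is_cyc_rotate)
  have pr: "rotate k p = pattern_of bs"
    by (simp add: vs(1) pattern_of_def bs(2)[symmetric] cyc_pairs_rotate)
  define cs where "cs = (if run_time False bs \<le> run_time True bs then bs else map swap_node bs)"
  have cs: "is_cyc edge cs" "run_time False cs \<le> run_time True cs"
    using bs(1) by (auto simp: cs_def run_time_swap)
  obtain l where l: "rooted (rotate l cs)"
    using ex_rooted[OF cs(1)] by blast
  obtain j where j: "pattern_of (rotate l cs) = rotate j (pattern_of cs)"
    using pattern_of_rotate by blast
  have "pattern_of cs = rotate k p \<or> pattern_of cs = interchange_colors (rotate k p)"
    by (simp add: cs_def pr pattern_of_swap)
  then have rel: "pattern_of (rotate l cs) = rotate (j + k) p \<or>
      pattern_of (rotate l cs) = interchange_colors (rotate (j + k) p)"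
    unfolding j by (auto simp: rotate_rotate interchange_rotate)
  have "length (pattern_of (rotate l cs)) = length p"
    using rel by (auto simp: interchange_colors_def)
  then have n: "run_time True (rotate l cs) + run_time False (rotate l cs) = n"
    using assms by (simp only: pattern_of_def length_cyc_pairs length_states_of)
      (simp add: prime_cycles_def)
  then have "rotate l cs \<in> rooted_cycles (\<le>) n"
    using l cs(2) by (simp add: rooted_cycles_def)
  moreover have "pattern_of (rotate l cs) \<in> prime_cycles n"
    using pattern_of_prime[of "rotate l cs"] cs(1) n by simp
  then have "(p, pattern_of (rotate l cs)) \<in> same_pattern n"
    using assms rel unfolding same_pattern_def by blast
  ultimately show ?thesis
    by blast
qed

text \<open>An interchange of colors would swap the two totals, against the strict inequality; a
  mere rotation between rooted lists is the identity.\<close>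

lemma rooted_cycles_same_pattern:
  assumes "bs \<in> rooted_cycles (<) n" "cs \<in> rooted_cycles (<) n"
    "(pattern_of bs, pattern_of cs) \<in> same_pattern n"
  shows "bs = cs"
proof -
  have b: "rooted bs" "run_time False bs < run_time True bs"
    and c: "rooted cs" "run_time False cs < run_time True cs"
    using assms(1,2) by (auto simp: rooted_cycles_def)
  have bc: "is_cyc edge bs" "is_cyc edge cs"
    using b c by (auto simp: rooted_def)
  consider k where "pattern_of cs = rotate k (pattern_of bs)"
    | k where "pattern_of cs = rotate k (pattern_of (map swap_node bs))"
    using assms(3) by (auto simp: same_pattern_def pattern_of_swap interchange_rotate)
  then show ?thesis
  proof cases
    case 1
    then show ?thesis
      using pattern_of_rotate_imp[OF bc] rooted_rotate_eq b(1) c(1) by metis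
  next
    case 2
    then obtain j where "cs = rotate j (map swap_node bs)"
      using pattern_of_rotate_imp[OF _ bc(2)] bc(1) by (metis is_cyc_edge_swap)
    then have "run_time True cs = run_time False bs" "run_time False cs = run_time True bs"
      by (simp_all add: run_time_swap)
    then show ?thesis
      using b(2) c(2) by simp
  qed
qed

text \<open>
  The color whose runs take longer in total can be made the orange one; only the patterns with equal
  totals are then possibly counted twice, and they turn out to be negligible.
\<close>

lemma num_colored_prime_patterns_bounds:
  assumes "finite (rooted_cycles (\<le>) n)"
  shows "card (rooted_cycles (<) n) \<le> num_colored_prime_patterns n"
    "num_colored_prime_patterns n \<le> card (rooted_cycles (\<le>) n)"
proof -
  define cl where "cl bs = same_pattern n `` {pattern_of bs}" for bs
  have pr: "pattern_of bs \<in> prime_cycles n" if "bs \<in> rooted_cycles R n" for bs R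
    using that pattern_of_prime[of bs] by (auto simp: rooted_cycles_def rooted_def)
  have sub: "prime_cycles n // same_pattern n \<subseteq> cl ` rooted_cycles (\<le>) n"
  proof
    fix X assume "X \<in> prime_cycles n // same_pattern n"
    then obtain p where p: "p \<in> prime_cycles n" "X = same_pattern n `` {p}"
      by (auto elim: quotientE)
    obtain bs where "bs \<in> rooted_cycles (\<le>) n" "(p, pattern_of bs) \<in> same_pattern n"
      using prime_cycle_rooted[OF p(1)] by blast
    then show "X \<in> cl ` rooted_cycles (\<le>) n"
      using p(2) equiv_class_eq[OF equiv_same_pattern] by (auto simp: cl_def)
  qed
  show "num_colored_prime_patterns n \<le> card (rooted_cycles (\<le>) n)"
    unfolding num_colored_prime_patterns_def using surj_card_le[OF assms sub] .
  have fin: "finite (prime_cycles n // same_pattern n)"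
    using sub assms by (meson finite_imageI finite_subset)
  have "inj_on cl (rooted_cycles (<) n)"
  proof (rule inj_onI)
    fix bs cs assume bc: "bs \<in> rooted_cycles (<) n" "cs \<in> rooted_cycles (<) n" "cl bs = cl cs"
    then have "(pattern_of bs, pattern_of cs) \<in> same_pattern n"
      unfolding cl_def using pr eq_equiv_class[OF _ equiv_same_pattern] by metis
    then show "bs = cs"
      using bc rooted_cycles_same_pattern by blast
  qed
  moreover have "cl ` rooted_cycles (<) n \<subseteq> prime_cycles n // same_pattern n"
    unfolding cl_def using pr by (auto intro: quotientI)
  ultimately show "card (rooted_cycles (<) n) \<le> num_colored_prime_patterns n"
    unfolding num_colored_prime_patterns_def using fin by (rule card_inj_on_le)
qed

section \<open>Runs\<close>

definition join_runs :: "(nat list \<times> nat list) list \<Rightarrow> (bool \<times> nat) list" where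
  "join_runs rs = concat (map (\<lambda>(as, bs). map (Pair True) as @ map (Pair False) bs) rs)"

abbreviation is_run :: "nat list \<Rightarrow> bool" where
  "is_run xs \<equiv> xs \<noteq> [] \<and> sorted_wrt (>) xs"

abbreviation run_pair :: "nat list \<times> nat list \<Rightarrow> bool" where
  "run_pair r \<equiv> is_run (fst r) \<and> is_run (snd r)"

lemma join_runs_Nil [simp]: "join_runs [] = []"
  by (simp add: join_runs_def)

lemma join_runs_Cons [simp]:
  "join_runs (r # rs) = map (Pair True) (fst r) @ map (Pair False) (snd r) @ join_runs rs"
  by (simp add: join_runs_def case_prod_unfold)

lemma sorted_wrt_greater_Cons:
  "sorted_wrt (>) (xs :: nat list) \<Longrightarrow> xs = [] \<or> hd xs < x \<Longrightarrow> sorted_wrt (>) (x # xs)"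
  by (cases xs) auto

text \<open>A suffix may begin inside a blue run whose orange partner has not been met yet; the
  leading block \<open>bs\<close>, possibly empty, holds this unpaired part.\<close>

lemma ex_join_runs:
  assumes "successively edge xs" "xs \<noteq> [] \<Longrightarrow> \<not> fst (last xs)"
  shows "\<exists>bs rs. xs = map (Pair False) bs @ join_runs rs \<and> sorted_wrt (>) bs \<and> (\<forall>r \<in> set rs. run_pair r)"
  using assms
proof (induction xs)
  case Nil
  then show ?case
    by (intro exI[of _ "[]"]) simp
next
  case (Cons x xs)
  have "xs \<noteq> [] \<Longrightarrow> \<not> fst (last xs)"
    using Cons.prems(2) by simp
  moreover have sx: "successively edge xs"
    using Cons.prems(1) by (auto simp: successively_Cons)
  ultimately obtain bs rs where IH: "xs = map (Pair False) bs @ join_runs rs" "sorted_wrt (>) bs"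
      "\<forall>r \<in> set rs. run_pair r"
    using Cons.IH by blast
  have e: "edge x (hd xs)" if "xs \<noteq> []"
    using Cons.prems(1) that by (auto simp: successively_Cons)
  obtain c d where x: "x = (c, d)"
    by fastforce
  show ?case
  proof (cases c)
    case False
    have "bs = [] \<or> hd bs < d"
      using e x False IH(1) by (cases bs) auto
    then have "sorted_wrt (>) (d # bs)"
      by (rule sorted_wrt_greater_Cons[OF IH(2)])
    then show ?thesis
      using IH x False by (intro exI[of _ "d # bs"] exI[of _ rs]) auto
  next
    case True
    then have ne: "xs \<noteq> []"
      using Cons.prems(2) x by auto
    show ?thesis
    proof (cases "bs = []")
      case False
      then show ?thesis
        using IH x True by (intro exI[of _ "[]"] exI[of _ "([d], bs) # rs"]) auto
    next
      case bs: True
      then obtain as cs rs' where rs: "rs = (as, cs) # rs'"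
        using ne IH(1) by (cases rs) auto
      have as: "as \<noteq> []" "sorted_wrt (>) as"
        using IH(3) rs by auto
      then have "hd as < d"
        using e ne x True IH(1) bs rs by (cases as) auto
      then have "sorted_wrt (>) (d # as)"
        using sorted_wrt_greater_Cons[OF as(2)] by blast
      then show ?thesis
        using IH x True bs rs by (intro exI[of _ "[]"] exI[of _ "(d # as, cs) # rs'"]) auto
    qed
  qed
qed

text \<open>As no run is empty, the changes of color mark all boundaries, and cutting at the first
  change of color recovers one run at a time.\<close>

lemma join_runs_inject:
  assumes "\<forall>r \<in> set rs. run_pair r" "\<forall>r \<in> set rs'. run_pair r" "join_runs rs = join_runs rs'"
  shows "rs = rs'"
  using assms
proof (induction rs arbitrary: rs')
  case Nil
  then show ?case
    by (cases rs') auto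
next
  case (Cons r rs)
  then obtain r' rs'' where rs': "rs' = r' # rs''"
    by (cases rs') auto
  have tw: "takeWhile fst (map (Pair True) as @ map (Pair False) bs @ zs) = map (Pair True) as"
    "dropWhile fst (map (Pair True) as @ map (Pair False) bs @ zs) = map (Pair False) bs @ zs"
    if "bs \<noteq> []" for as bs and zs :: "(bool \<times> nat) list"
    using that by (induction as; cases bs; simp)+
  have tw': "takeWhile (Not \<circ> fst) (map (Pair False) bs @ join_runs qs) = map (Pair False) bs"
    "dropWhile (Not \<circ> fst) (map (Pair False) bs @ join_runs qs) = join_runs qs"
    if "\<forall>r \<in> set qs. run_pair r" for bs qs
  proof -
    have "qs = [] \<or> (\<exists>d ys. join_runs qs = (True, d) # ys)"
      using that by (cases qs; cases "fst (hd qs)") auto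
    then show "takeWhile (Not \<circ> fst) (map (Pair False) bs @ join_runs qs) = map (Pair False) bs"
      "dropWhile (Not \<circ> fst) (map (Pair False) bs @ join_runs qs) = join_runs qs"
      by (induction bs; auto)+
  qed
  have inj: "map (Pair c) as = map (Pair c) bs \<Longrightarrow> as = bs" for c :: bool and as bs :: "nat list"
    by (rule map_injective) (auto simp: inj_def)
  have eq: "map (Pair True) (fst r) @ map (Pair False) (snd r) @ join_runs rs =
      map (Pair True) (fst r') @ map (Pair False) (snd r') @ join_runs rs''"
    using Cons.prems(3) rs' by simp
  have ne: "snd r \<noteq> []" "snd r' \<noteq> []" and g: "\<forall>r \<in> set rs. run_pair r" "\<forall>r \<in> set rs''. run_pair r"
    using Cons.prems rs' by auto
  have "fst r = fst r'"
    using arg_cong[OF eq, of "takeWhile fst"] tw(1)[OF ne(1)] tw(1)[OF ne(2)] inj by metis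
  moreover have eq2: "map (Pair False) (snd r) @ join_runs rs = map (Pair False) (snd r') @ join_runs rs''"
    using arg_cong[OF eq, of "dropWhile fst"] tw(2)[OF ne(1)] tw(2)[OF ne(2)] by metis
  moreover have "snd r = snd r'"
    using arg_cong[OF eq2, of "takeWhile (Not \<circ> fst)"] tw'(1)[OF g(1)] tw'(1)[OF g(2)] inj by metis
  moreover have "join_runs rs = join_runs rs''"
    using arg_cong[OF eq2, of "dropWhile (Not \<circ> fst)"] tw'(2)[OF g(1)] tw'(2)[OF g(2)] by metis
  ultimately show ?case
    using Cons.IH[OF g] rs' by (simp add: prod_eq_iff)
qed

lemma set_join_runs: "set (join_runs rs) =
    Pair True ` set (concat (map fst rs)) \<union> Pair False ` set (concat (map snd rs))"
  by (induction rs) auto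

lemma distinct_join_runs: "distinct (join_runs rs) \<longleftrightarrow>
    distinct (concat (map fst rs)) \<and> distinct (concat (map snd rs))"
proof (induction rs)
  case (Cons r rs)
  have "distinct (map (Pair c) xs) = distinct xs" for c :: bool and xs :: "nat list"
    by (simp add: distinct_map inj_on_def)
  moreover have "set (map (Pair True) (fst r)) \<inter> set (map (Pair False) (snd r)) = {}"
    by auto
  moreover have "set (map (Pair True) (fst r)) \<inter> set (join_runs rs) = {} \<longleftrightarrow>
      set (fst r) \<inter> set (concat (map fst rs)) = {}"
    unfolding set_join_runs set_map by blast
  moreover have "set (map (Pair False) (snd r)) \<inter> set (join_runs rs) = {} \<longleftrightarrow>
      set (snd r) \<inter> set (concat (map snd rs)) = {}"
    unfolding set_join_runs set_map by blast
  ultimately show ?case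
    using Cons unfolding join_runs_Cons distinct_append set_append list.map concat.simps
    by (simp only: Int_Un_distrib Un_empty) blast
qed simp

lemma successively_run:
  assumes "is_run xs" "successively edge ((c, last xs) # ys)"
  shows "successively edge (map (Pair c) xs @ ys)"
  using assms
proof (induction xs)
  case (Cons x xs)
  show ?case
  proof (cases xs)
    case (Cons y zs)
    then have "successively edge (map (Pair c) xs @ ys)"
      using Cons.IH Cons.prems by simp
    then show ?thesis
      using Cons.prems Cons by (simp add: successively_Cons)
  qed (use Cons.prems in simp)
qed simp

text \<open>The blue number \<open>l\<close> in front can be arbitrary because a change of color is
  always an edge. This covers both the joints between pairs and the closing arc of the
  cycle.\<close>

lemma successively_join_runs:
  assumes "\<forall>r \<in> set rs. run_pair r"
  shows "successively edge ((False, l) # join_runs rs)"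
  using assms
proof (induction rs arbitrary: l)
  case (Cons r rs)
  define as bs where "as = fst r" and "bs = snd r"
  have runs: "is_run as" "is_run bs"
    using Cons.prems by (auto simp: as_def bs_def)
  have "successively edge (map (Pair False) bs @ join_runs rs)"
    using runs Cons by (intro successively_run) auto
  then have "successively edge ((True, last as) # map (Pair False) bs @ join_runs rs)"
    using runs by (cases bs) (auto simp: successively_Cons)
  then have "successively edge (map (Pair True) as @ map (Pair False) bs @ join_runs rs)"
    using runs by (intro successively_run) auto
  then show ?case
    using runs by (cases as) (auto simp: successively_Cons as_def bs_def)
qed simp

lemma last_join_runs:
  assumes "\<forall>r \<in> set rs. run_pair r" "rs \<noteq> []"
  shows "\<not> fst (last (join_runs rs))" "join_runs rs \<noteq> []"
proof -
  have "\<not> fst (last (join_runs rs)) \<and> join_runs rs \<noteq> []"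
    using assms
  proof (induction rs)
    case (Cons r rs)
    then show ?case
      by (cases "rs = []") (auto simp: last_append last_map)
  qed simp
  then show "\<not> fst (last (join_runs rs))" "join_runs rs \<noteq> []"
    by auto
qed

text \<open>Once each run decreases, adjacency imposes nothing more; only disjointness within each
  color and the choice of the root remain. This is what makes counting each color separately
  possible.\<close>

lemma rooted_iff: "rooted bs \<longleftrightarrow> (\<exists>rs. bs = join_runs rs \<and> rs \<noteq> [] \<and> (\<forall>r \<in> set rs. run_pair r) \<and>
    distinct (concat (map fst rs)) \<and> distinct (concat (map snd rs)) \<and>
    (\<forall>r \<in> set rs. hd (fst r) \<le> hd (fst (hd rs))))"
  (is "_ \<longleftrightarrow> (\<exists>rs. ?Q rs)")
proof
  assume r: "rooted bs"
  then have bs: "bs \<noteq> []" "distinct bs" "successively edge bs" "fst (hd bs)"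
    by (auto simp: rooted_def is_cyc_successively successively_Cons)
  obtain cs rs where rs: "bs = map (Pair False) cs @ join_runs rs" "\<forall>r \<in> set rs. run_pair r"
    using ex_join_runs[OF bs(3)] rooted_last[OF r] by blast
  have cs: "cs = []"
    using rs(1) bs(4) by (cases cs) auto
  have ne: "rs \<noteq> []"
    using cs rs(1) bs(1) by auto
  have h: "hd bs = (True, hd (fst (hd rs)))"
    using cs rs ne by (cases rs; cases "fst (hd rs)") auto
  have "hd (fst q) \<le> hd (fst (hd rs))" if "q \<in> set rs" for q
  proof -
    have "hd (fst q) \<in> set (fst q)"
      using that rs(2) by auto
    then have "(True, hd (fst q)) \<in> set bs"
      using that rs(1) by (auto simp: set_join_runs)
    then show ?thesis
      using r h by (auto simp: rooted_def)
  qed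
  then have "?Q rs"
    using rs cs ne bs(2) by (simp add: distinct_join_runs)
  then show "\<exists>rs. ?Q rs" ..
next
  assume "\<exists>rs. ?Q rs"
  then obtain rs where rs: "bs = join_runs rs" "rs \<noteq> []" "\<forall>r \<in> set rs. run_pair r"
    "distinct (concat (map fst rs))" "distinct (concat (map snd rs))"
    "\<forall>r \<in> set rs. hd (fst r) \<le> hd (fst (hd rs))"
    by blast
  have l: "\<not> fst (last bs)" "bs \<noteq> []"
    using last_join_runs[OF rs(3,2)] rs(1) by auto
  then have "last bs = (False, snd (last bs))"
    by (simp add: prod_eq_iff)
  then have "successively edge (last bs # bs)"
    using successively_join_runs[OF rs(3)] rs(1) by metis
  then have cyc: "is_cyc edge bs"
    using l rs(1,4,5) by (simp add: is_cyc_successively distinct_join_runs)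
  have h: "hd bs = (True, hd (fst (hd rs)))"
    using rs by (cases rs; cases "fst (hd rs)") auto
  have "d \<le> hd (fst (hd rs))" if "(True, d) \<in> set bs" for d
  proof -
    obtain q where q: "q \<in> set rs" "d \<in> set (fst q)"
      using \<open>(True, d) \<in> set bs\<close> by (auto simp: rs(1) set_join_runs)
    then have "d \<le> hd (fst q)"
      using rs(3) by (cases "fst q") fastforce+
    then show ?thesis
      using q rs(6) by fastforce
  qed
  then show "rooted bs"
    using cyc h by (simp add: rooted_def)
qed

section \<open>Durations of runs\<close>

fun path_time :: "bool \<Rightarrow> bool \<times> nat \<Rightarrow> (bool \<times> nat) list \<Rightarrow> nat" where
  "path_time c a [] = 0"
| "path_time c a (b # bs) = (if fst a = c then cost a b else 0) + path_time c b bs"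

lemma run_time_path_time: "run_time c bs = path_time c (last bs) bs"
proof -
  have "sum_list (map (\<lambda>(x, y). if fst x = c then cost x y else 0) (zip (a # butlast bs) bs))
      = path_time c a bs" for a
    by (induction c a bs rule: path_time.induct) auto
  then show ?thesis
    by (simp add: run_time_def cyc_pairs_def)
qed

lemma path_time_append:
  "path_time c a (xs @ ys) = path_time c a xs + path_time c (last (a # xs)) ys"
  by (induction c a xs rule: path_time.induct) auto

text \<open>The differences along the run telescope; the last entry is added on the left to avoid
  subtraction.\<close>

lemma path_time_run: "is_run (x # xs) \<Longrightarrow> path_time c (c, x) (map (Pair c) xs) + last (x # xs) = x"
proof (induction xs arbitrary: x)
  case (Cons y xs)
  then have "path_time c (c, y) (map (Pair c) xs) + last (y # xs) = y" "y < x"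
    by auto
  then show ?case
    by simp
qed simp

lemma path_time_other: "c \<noteq> c' \<Longrightarrow> path_time c (c', x) (map (Pair c') xs) = 0"
  by (induction xs arbitrary: x) auto

text \<open>The run of color \<open>c\<close> is complete: its telescoped differences and the change
  of color behind it add up to \<open>Suc (hd as)\<close>. For \<open>c'\<close> the books are
  shifted: \<open>Suc l\<close> pays the end of the previous run of that color, while the end of the
  present one is left to the next pair.\<close>

lemma path_time_run_pair:
  assumes "is_run as" "is_run bs" "c \<noteq> c'"
  shows "path_time c (c', l) (map (Pair c) as @ map (Pair c') bs) = Suc (hd as)"
    "path_time c' (c', l) (map (Pair c) as @ map (Pair c') bs) + last bs = Suc l + hd bs"
proof -
  obtain a as' b bs' where ab: "as = a # as'" "bs = b # bs'"
    using assms by (metis list.exhaust)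
  have l: "last ((c, a) # map (Pair c) as') = (c, last as)" for c :: bool
    by (simp add: ab last_map)
  have "path_time c (c, last as) (map (Pair c') bs) = Suc (last as)"
    using assms by (simp add: ab path_time_other)
  then show "path_time c (c', l) (map (Pair c) as @ map (Pair c') bs) = Suc (hd as)"
    using path_time_run[of a as' c] assms l by (simp add: ab path_time_append)
  have "path_time c' (c, last as) (map (Pair c') bs) + last bs = b"
    using path_time_run[of b bs' c'] assms by (simp add: ab)
  then show "path_time c' (c', l) (map (Pair c) as @ map (Pair c') bs) + last bs = Suc l + hd bs"
    using path_time_other[of c' c a as'] assms l by (simp add: ab path_time_append)
qed

lemma path_time_join_runs:
  assumes "\<forall>r \<in> set rs. run_pair r"
  shows "path_time True (False, l) (join_runs rs) = (\<Sum>r\<leftarrow>rs. Suc (hd (fst r)))"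
    "path_time False (False, l) (join_runs rs) + snd (last ((False, l) # join_runs rs))
      = l + (\<Sum>r\<leftarrow>rs. Suc (hd (snd r)))"
proof -
  have "path_time True (False, l) (join_runs rs) = (\<Sum>r\<leftarrow>rs. Suc (hd (fst r))) \<and>
    path_time False (False, l) (join_runs rs) + snd (last ((False, l) # join_runs rs))
      = l + (\<Sum>r\<leftarrow>rs. Suc (hd (snd r)))"
    using assms
  proof (induction rs arbitrary: l)
    case (Cons r rs)
    define xs where "xs = map (Pair True) (fst r) @ map (Pair False) (snd r)"
    have r: "is_run (fst r)" "is_run (snd r)"
      using Cons.prems by auto
    have l: "last ((False, l) # xs) = (False, last (snd r))"
      using r by (simp add: xs_def last_append last_map)
    have j: "join_runs (r # rs) = xs @ join_runs rs"
      by (simp add: xs_def)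
    have l': "last ((False, l) # xs @ join_runs rs) = last ((False, last (snd r)) # join_runs rs)"
      using l by (metis append_Cons last.simps last_append)
    note IH = Cons.IH[of "last (snd r)"]
    show ?case
      using IH Cons.prems path_time_run_pair[OF r, of True False l, folded xs_def]
      unfolding j path_time_append l l' by simp
  qed simp
  then show "path_time True (False, l) (join_runs rs) = (\<Sum>r\<leftarrow>rs. Suc (hd (fst r)))"
    "path_time False (False, l) (join_runs rs) + snd (last ((False, l) # join_runs rs))
      = l + (\<Sum>r\<leftarrow>rs. Suc (hd (snd r)))"
    by blast+
qed

lemma run_time_join_runs:
  assumes "\<forall>r \<in> set rs. run_pair r" "rs \<noteq> []"
  shows "run_time True (join_runs rs) = (\<Sum>r\<leftarrow>rs. Suc (hd (fst r)))"
    "run_time False (join_runs rs) = (\<Sum>r\<leftarrow>rs. Suc (hd (snd r)))"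
proof -
  \<comment> \<open>With \<open>l\<close> the last blue number, the two boundary terms of
    \<open>path_time_join_runs\<close> coincide and cancel: the end missing from the last blue run
    is the one charged at the start.\<close>
  define l where "l = snd (last (join_runs rs))"
  have l: "last (join_runs rs) = (False, l)" "join_runs rs \<noteq> []"
    using last_join_runs[OF assms] by (auto simp: l_def prod_eq_iff)
  show "run_time True (join_runs rs) = (\<Sum>r\<leftarrow>rs. Suc (hd (fst r)))"
    unfolding run_time_path_time l by (rule path_time_join_runs(1)[OF assms(1)])
  show "run_time False (join_runs rs) = (\<Sum>r\<leftarrow>rs. Suc (hd (snd r)))"
    unfolding run_time_path_time l using path_time_join_runs(2)[OF assms(1), of l] l by simp
qed

section \<open>Rooted cycles as pairs of lists of runs\<close>

definition run_lists :: "nat \<Rightarrow> nat \<Rightarrow> nat list list set" where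
  "run_lists t m = {xs. length xs = t \<and> (\<forall>x \<in> set xs. is_run x) \<and> distinct (concat xs)
     \<and> (\<Sum>x\<leftarrow>xs. Suc (hd x)) = m}"

text \<open>Position 0 describes the orange runs of a rooted cycle. The other positions serve to
  count all of \<open>run_lists\<close> by the place of the largest number.\<close>

definition peaked_run_lists :: "nat \<Rightarrow> nat \<Rightarrow> nat \<Rightarrow> nat list list set" where
  "peaked_run_lists c t m = {xs \<in> run_lists t m. \<forall>x \<in> set xs. hd x \<le> hd (xs ! c)}"

lemma run_lists_length_le: "xs \<in> run_lists t m \<Longrightarrow> t \<le> m"
proof -
  have "length xs \<le> (\<Sum>x\<leftarrow>xs. Suc (hd x))" for xs :: "nat list list"
    by (induction xs) auto
  then show "xs \<in> run_lists t m \<Longrightarrow> t \<le> m"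
    by (auto simp: run_lists_def)
qed

text \<open>Here \<open>t\<close> is the number of runs of each color and \<open>j\<close> the blue
  total; \<open>t \<le> n\<close> holds because every run lasts at least one beat. Rooting concerns
  the orange runs only, so the blue ones form an arbitrary run list.\<close>

lemma bij_betw_rooted_cycles:
  defines "I \<equiv> \<lambda>R n. SIGMA t:{1..n}. SIGMA j:{j. j \<le> n \<and> R j (n - j)}.
    peaked_run_lists 0 t (n - j) \<times> run_lists t j"
  shows "bij_betw (\<lambda>(t, j, xs, ys). join_runs (zip xs ys)) (I R n) (rooted_cycles R n)"
  unfolding bij_betw_def
proof
  let ?f = "\<lambda>(t, j, xs, ys). join_runs (zip xs ys)"
  have runs: "length xs = t" "length ys = t" "\<forall>x \<in> set xs. is_run x" "\<forall>y \<in> set ys. is_run y"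
    "distinct (concat xs)" "distinct (concat ys)"
    "(\<Sum>x\<leftarrow>xs. Suc (hd x)) = n - j" "(\<Sum>y\<leftarrow>ys. Suc (hd y)) = j" "1 \<le> t" "j \<le> n" "R j (n - j)"
    "\<forall>x \<in> set xs. hd x \<le> hd (xs ! 0)"
    if "(t, j, xs, ys) \<in> I R n" for t j xs ys
    using that by (auto simp: I_def run_lists_def peaked_run_lists_def)
  have pairs: "\<forall>r \<in> set (zip xs ys). run_pair r" if "(t, j, xs, ys) \<in> I R n" for t j xs ys
    using runs(3,4)[OF that] by (auto dest: set_zip_leftD set_zip_rightD)
  have maps: "map fst (zip xs ys) = xs" "map snd (zip xs ys) = ys"
    if "(t, j, xs, ys) \<in> I R n" for t j xs ys
    using runs(1,2)[OF that] by auto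
  show "inj_on ?f (I R n)"
  proof (rule inj_onI)
    fix z z' assume z: "z \<in> I R n" "z' \<in> I R n" "?f z = ?f z'"
    obtain t j xs ys t' j' xs' ys' where zz: "z = (t, j, xs, ys)" "z' = (t', j', xs', ys')"
      by (metis prod_cases4)
    then have a: "(t, j, xs, ys) \<in> I R n" and b: "(t', j', xs', ys') \<in> I R n"
      and "join_runs (zip xs ys) = join_runs (zip xs' ys')"
      using z by auto
    then have "zip xs ys = zip xs' ys'"
      using join_runs_inject pairs by meson
    then have "xs = xs'" "ys = ys'"
      using maps[OF a] maps[OF b] by metis+
    then show "z = z'"
      using zz runs(1,8)[OF a] runs(1,8)[OF b] by simp
  qed
  show "?f ` I R n = rooted_cycles R n"
  proof (intro equalityI subsetI)
    fix bs assume "bs \<in> ?f ` I R n"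
    then obtain t j xs ys where a: "(t, j, xs, ys) \<in> I R n" and bs: "bs = join_runs (zip xs ys)"
      by auto
    note r = runs[OF a] and p = pairs[OF a] and m = maps[OF a]
    have ne: "zip xs ys \<noteq> []"
      using r(1,2,9) by auto
    have h: "fst (hd (zip xs ys)) = xs ! 0"
      using r(1,2,9) by (cases xs; cases ys) auto
    have "\<forall>r \<in> set (zip xs ys). hd (fst r) \<le> hd (fst (hd (zip xs ys)))"
      unfolding h using r(12) by (auto dest: set_zip_leftD)
    then have "rooted bs"
      unfolding rooted_iff using bs ne p r(5,6) m by metis
    moreover have "run_time True bs = n - j" "run_time False bs = j"
      using run_time_join_runs[OF p ne] r(7,8) m unfolding bs
      by (metis (no_types, lifting) comp_apply map_eq_conv map_map)+
    ultimately show "bs \<in> rooted_cycles R n"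
      using r(10,11) by (simp add: rooted_cycles_def)
  next
    fix bs assume b: "bs \<in> rooted_cycles R n"
    then obtain rs where rs: "bs = join_runs rs" "rs \<noteq> []" "\<forall>r \<in> set rs. run_pair r"
      "distinct (concat (map fst rs))" "distinct (concat (map snd rs))"
      "\<forall>r \<in> set rs. hd (fst r) \<le> hd (fst (hd rs))"
      by (auto simp: rooted_cycles_def rooted_iff)
    define xs ys j where "xs = map fst rs" and "ys = map snd rs" and "j = run_time False bs"
    have z: "zip xs ys = rs"
      by (simp add: xs_def ys_def zip_map_fst_snd)
    have n: "run_time True bs = n - j" "j \<le> n" "R j (n - j)"
      using b by (auto simp: rooted_cycles_def j_def)
    have "xs \<in> run_lists (length rs) (n - j)" "ys \<in> run_lists (length rs) j"
      using rs n(1) run_time_join_runs[OF rs(3,2)]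
      by (auto simp: run_lists_def xs_def ys_def j_def comp_def)
    moreover have "hd x \<le> hd (xs ! 0)" if "x \<in> set xs" for x
      using that rs(2,6) by (auto simp: xs_def hd_conv_nth)
    moreover have "length rs \<in> {1..n}"
      using run_lists_length_le[OF calculation(1)] rs(2) by (cases rs) auto
    ultimately have "(length rs, j, xs, ys) \<in> I R n"
      using n by (auto simp: I_def peaked_run_lists_def)
    then show "bs \<in> ?f ` I R n"
      using z rs(1) by force
  qed
qed

section \<open>Counting runs\<close>

text \<open>
  \<open>run_count t m\<close> is the number of sets of \<open>t\<close> disjoint nonempty finite sets of positive integers
  whose maxima add up to \<open>m\<close>.  The recursion shifts all integers down by one: the number 1 belonged
  to one of the \<open>t\<close> sets or to none of them, or it formed a set on its own.
\<close>

fun run_count :: "nat \<Rightarrow> nat \<Rightarrow> nat" where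
  "run_count 0 m = (if m = 0 then 1 else 0)"
| "run_count (Suc t) m = (if m < Suc t then 0
     else (t + 2) * run_count (Suc t) (m - Suc t) + run_count t (m - Suc t))"

declare run_count.simps(2) [simp del]

text \<open>Labelled set systems as functions: \<open>f d\<close> is the label of the set containing
  \<open>Suc d\<close>, and 0 means no set. The largest number used must have label
  \<open>c\<close>, which leaves \<open>(card C - 1)!\<close> labellings of each system. The label
  set \<open>C\<close> is general because the recursion may remove any label except
  \<open>c\<close>.\<close>

definition colorings :: "nat \<Rightarrow> nat set \<Rightarrow> nat \<Rightarrow> (nat \<Rightarrow> nat) set" where
  "colorings c C m = {f. range f \<subseteq> insert 0 C \<and> C \<subseteq> range f
     \<and> (\<exists>d. f d = c \<and> (\<forall>e > d. f e = 0)) \<and> (\<Sum>i\<in>C. Suc (Max {d. f d = i})) = m}"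

lemma colorings_range:
  "f \<in> colorings c C m \<Longrightarrow> range f \<subseteq> insert 0 C"
  "f \<in> colorings c C m \<Longrightarrow> C \<subseteq> range f"
  by (simp_all add: colorings_def)

lemma range_case_nat: "range (case_nat a g) = insert a (range g)"
proof (intro equalityI subsetI)
  fix x assume "x \<in> range (case_nat a g)"
  then show "x \<in> insert a (range g)"
    by (auto split: nat.splits)
next
  fix x assume "x \<in> insert a (range g)"
  then have "x = case_nat a g 0 \<or> (\<exists>d. x = case_nat a g (Suc d))"
    by auto
  then show "x \<in> range (case_nat a g)"
    by blast
qed

lemma case_nat_eta: "case_nat (f 0) (\<lambda>d. f (Suc d)) = f"
  by (rule ext) (auto split: nat.splits)

lemma Max_case_nat:
  assumes "finite {d. g d = i}" "{d. g d = i} \<noteq> {}"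
  shows "Max {d. case_nat a g d = i} = Suc (Max {d. g d = i})"
proof -
  have eq: "{d. case_nat a g d = i} = Suc ` {d. g d = i} \<union> (if a = i then {0} else {})"
  proof (intro set_eqI)
    fix d show "d \<in> {d. case_nat a g d = i} \<longleftrightarrow> d \<in> Suc ` {d. g d = i} \<union> (if a = i then {0} else {})"
      by (cases d) auto
  qed
  have "Max (Suc ` {d. g d = i}) = Suc (Max {d. g d = i})"
    using assms by (simp add: mono_Max_commute mono_def)
  then show ?thesis
    unfolding eq using assms by (auto simp: Max_insert)
qed

lemma Max_case_nat_new:
  assumes "i \<notin> range g"
  shows "Max {d. case_nat i g d = i} = 0"
proof -
  have "{d. case_nat i g d = i} = {0}"
    using assms by (auto split: nat.splits) (metis old.nat.exhaust rangeI)
  then show ?thesis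
    by simp
qed

lemma finite_color_class:
  fixes f :: "nat \<Rightarrow> nat"
  assumes "\<forall>e > d. f e = 0" "i \<noteq> 0"
  shows "finite {d. f d = i}"
proof (rule finite_subset)
  show "{d. f d = i} \<subseteq> {..d}"
  proof
    fix e assume "e \<in> {d. f d = i}"
    then have "\<not> e > d"
      using assms by auto
    then show "e \<in> {..d}"
      by simp
  qed
qed simp

lemma ex_last_case_nat:
  assumes "c \<noteq> 0" "g \<noteq> (\<lambda>_. 0)"
  shows "(\<exists>d. case_nat a g d = c \<and> (\<forall>e > d. case_nat a g e = 0)) \<longleftrightarrow>
    (\<exists>d. g d = c \<and> (\<forall>e > d. g e = 0))"
proof
  assume "\<exists>d. case_nat a g d = c \<and> (\<forall>e > d. case_nat a g e = 0)"
  then obtain d where d: "case_nat a g d = c" "\<And>e. e > d \<Longrightarrow> case_nat a g e = 0"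
    by blast
  show "\<exists>d. g d = c \<and> (\<forall>e > d. g e = 0)"
  proof (cases d)
    case 0
    have "g e = 0" for e
      using d(2)[of "Suc e"] 0 by simp
    then show ?thesis
      using assms(2) by blast
  next
    case (Suc d')
    have "g e = 0" if "e > d'" for e
      using d(2)[of "Suc e"] Suc that by simp
    then show ?thesis
      using d(1) Suc by auto
  qed
next
  assume "\<exists>d. g d = c \<and> (\<forall>e > d. g e = 0)"
  then obtain d where "g d = c" "\<forall>e > d. g e = 0"
    by blast
  then have "case_nat a g (Suc d) = c \<and> (\<forall>e > Suc d. case_nat a g e = 0)"
    by (auto split: nat.splits)
  then show "\<exists>d. case_nat a g d = c \<and> (\<forall>e > d. case_nat a g e = 0)"
    by blast
qed

lemma card_le_colorings:
  assumes "f \<in> colorings c C m"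
  shows "card C \<le> m"
proof -
  have "card C = (\<Sum>i\<in>C. 1)"
    by simp
  also have "\<dots> \<le> (\<Sum>i\<in>C. Suc (Max {d. f d = i}))"
    by (intro sum_mono) simp
  finally show ?thesis
    using assms by (simp add: colorings_def)
qed

lemma sum_Max_case_nat:
  assumes C: "finite C" "0 \<notin> C" and g: "C \<subseteq> range g" "\<forall>e > d. g e = (0::nat)"
  shows "(\<Sum>i\<in>C. Suc (Max {d. case_nat a g d = i})) = (\<Sum>i\<in>C. Suc (Max {d. g d = i})) + card C"
proof -
  have "Suc (Max {d. case_nat a g d = i}) = Suc (Max {d. g d = i}) + 1" if "i \<in> C" for i
  proof -
    have "i \<noteq> 0"
      using that C(2) by metis
    moreover have "{d. g d = i} \<noteq> {}"
      using that g(1) by auto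
    ultimately have "finite {d. g d = i}" "{d. g d = i} \<noteq> {}"
      using finite_color_class[OF g(2)] by blast+
    then show ?thesis
      using Max_case_nat[of g i a] by simp
  qed
  then have "(\<Sum>i\<in>C. Suc (Max {d. case_nat a g d = i})) = (\<Sum>i\<in>C. Suc (Max {d. g d = i}) + 1)"
    by (intro sum.cong refl)
  also have "\<dots> = (\<Sum>i\<in>C. Suc (Max {d. g d = i})) + card C"
    by (simp only: sum.distrib) simp
  finally show ?thesis .
qed

text \<open>Deleting the entry at 0 shifts everything down. If the label \<open>a\<close> is lost,
  its set was a singleton contributing 1, and the other \<open>card C - 1\<close> maxima drop by 1;
  otherwise all \<open>card C\<close> maxima drop. Either way the total decreases by
  \<open>card C\<close>. The label \<open>c\<close> cannot be lost, as it still marks the last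
  nonzero entry of \<open>g\<close>.\<close>

lemma case_nat_colorings:
  assumes C: "finite C" "0 \<notin> C" "c \<in> C" and g: "g \<noteq> (\<lambda>_. 0)"
  shows "case_nat a g \<in> colorings c C m \<longleftrightarrow> card C \<le> m \<and>
    (a \<in> insert 0 C \<and> g \<in> colorings c C (m - card C) \<or>
     a \<in> C - {c} \<and> g \<in> colorings c (C - {a}) (m - card C))"
    (is "?L \<longleftrightarrow> _ \<and> (?A \<or> ?B)")
proof -
  have c: "c \<noteq> 0"
    using C by metis
  note ll = ex_last_case_nat[OF c g, of a]
  have old: "(\<Sum>i\<in>C. Suc (Max {d. case_nat a g d = i})) = (\<Sum>i\<in>C. Suc (Max {d. g d = i})) + card C"
    if "C \<subseteq> range g" "\<exists>d. g d = c \<and> (\<forall>e > d. g e = 0)"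
    using sum_Max_case_nat[OF C(1,2)] that by blast
  have new: "(\<Sum>i\<in>C. Suc (Max {d. case_nat a g d = i}))
      = (\<Sum>i\<in>C - {a}. Suc (Max {d. g d = i})) + card C"
    if "a \<in> C" "a \<notin> range g" "C - {a} \<subseteq> range g" "\<exists>d. g d = c \<and> (\<forall>e > d. g e = 0)"
  proof -
    have "(\<Sum>i\<in>C. Suc (Max {d. case_nat a g d = i}))
        = Suc 0 + (\<Sum>i\<in>C - {a}. Suc (Max {d. case_nat a g d = i}))"
      using C(1) that(1) Max_case_nat_new[OF that(2)] by (simp add: sum.remove)
    also have "(\<Sum>i\<in>C - {a}. Suc (Max {d. case_nat a g d = i}))
        = (\<Sum>i\<in>C - {a}. Suc (Max {d. g d = i})) + card (C - {a})"
      using sum_Max_case_nat[of "C - {a}"] C that(3,4) by blast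
    finally show ?thesis
      using C(1) that(1) by (simp add: card_Diff_singleton card_gt_0_iff)
        (metis One_nat_def Suc_pred card_gt_0_iff empty_iff)
  qed
  show ?thesis
  proof
    assume L: ?L
    then have r: "insert a (range g) \<subseteq> insert 0 C" "C \<subseteq> insert a (range g)"
      "\<exists>d. g d = c \<and> (\<forall>e > d. g e = 0)" "(\<Sum>i\<in>C. Suc (Max {d. case_nat a g d = i})) = m"
      by (auto simp: colorings_def range_case_nat ll)
    show "card C \<le> m \<and> (?A \<or> ?B)"
    proof (cases "C \<subseteq> range g")
      case True
      then have ?A
        using r old by (auto simp: colorings_def)
      then show ?thesis
        using card_le_colorings[OF L] by blast
    next
      case False
      then have a: "a \<in> C" "a \<notin> range g"
        using r(2) by auto
      moreover have "a \<noteq> c"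
        using a(2) r(3) by auto
      moreover have "C - {a} \<subseteq> range g" "range g \<subseteq> insert 0 (C - {a})"
        using r(1,2) a by auto
      ultimately have ?B
        using r(3,4) new by (auto simp: colorings_def)
      then show ?thesis
        using card_le_colorings[OF L] by blast
    qed
  next
    assume R: "card C \<le> m \<and> (?A \<or> ?B)"
    then consider ?A | ?B
      by blast
    then show ?L
    proof cases
      case 1
      then show ?thesis
        using R old by (auto simp: colorings_def range_case_nat ll)
    next
      case 2
      then have "a \<notin> range g"
        using C by (auto simp: colorings_def)
      then show ?thesis
        using 2 R new by (auto simp: colorings_def range_case_nat ll)
    qed
  qed
qed

text \<open>The case where nothing remains after the deletion; it matches the initial value
  \<open>run_count 0 0 = 1\<close>.\<close>

lemma case_nat_zero_colorings:
  assumes C: "finite C" "0 \<notin> C" "c \<in> C"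
  shows "case_nat a (\<lambda>_. 0) \<in> colorings c C m \<longleftrightarrow> a = c \<and> C = {c} \<and> m = 1"
proof -
  have c: "c \<noteq> 0"
    using C by metis
  show ?thesis
  proof
    assume L: "case_nat a (\<lambda>_. 0) \<in> colorings c C m"
    then have "insert a {0} \<subseteq> insert 0 C" "C \<subseteq> insert a {0}"
      by (simp_all add: colorings_def range_case_nat)
    then have "a = c" "C = {c}"
      using C by auto
    moreover have "Max {d. case_nat c (\<lambda>_. 0) d = c} = 0"
      using c by (intro Max_case_nat_new) auto
    ultimately show "a = c \<and> C = {c} \<and> m = 1"
      using L by (simp add: colorings_def)
  next
    assume R: "a = c \<and> C = {c} \<and> m = 1"
    moreover have "Max {d. case_nat c (\<lambda>_. 0) d = c} = 0"
      using c by (intro Max_case_nat_new) auto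
    moreover have "\<exists>d. case_nat c (\<lambda>_. 0) d = c \<and> (\<forall>e > d. case_nat c (\<lambda>_. 0) e = 0)"
      by (intro exI[of _ 0]) (auto split: nat.splits)
    ultimately show "case_nat a (\<lambda>_. 0) \<in> colorings c C m"
      by (simp add: colorings_def range_case_nat)
  qed
qed

text \<open>In terms of \<open>k = card C - 1\<close>, keeping all labels (\<open>U\<close>) offers
  \<open>k + 2\<close> values for the first entry, 0 among them. Losing a label (\<open>V\<close>)
  offers \<open>k\<close> of them, and \<open>k * (k - 1)! = k!\<close> gives both summands the
  factor of the claim.\<close>

lemma card_colorings:
  assumes "finite C" "0 \<notin> C" "c \<in> C"
  shows "finite (colorings c C m) \<and> card (colorings c C m) = fact (card C - 1) * run_count (card C) m"
  using assms
proof (induction m arbitrary: C rule: less_induct)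
  case (less m)
  note C = less.prems
  obtain k where k: "card C = Suc k"
    using C by (metis card_gt_0_iff empty_iff gr0_implies_Suc)
  define U where "U = insert 0 C \<times> colorings c C (m - card C)"
  define V where "V = (SIGMA a:C - {c}. colorings c (C - {a}) (m - card C))"
  \<comment> \<open>For \<open>k = 0\<close> no label can be lost and \<open>V\<close> is empty;
    \<open>W\<close> then supplies the summand \<open>run_count 0 (m - 1)\<close>.\<close>
  define W where "W = (if C = {c} \<and> m = 1 then {(c, \<lambda>_::nat. 0::nat)} else {})"
  have inj: "inj_on (\<lambda>(a, g). case_nat a g) X" for X :: "(nat \<times> (nat \<Rightarrow> nat)) set"
  proof (rule inj_onI, clarify)
    fix a b :: nat and f g :: "nat \<Rightarrow> nat" assume eq: "case_nat a f = case_nat b g"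
    have "a = b"
      using fun_cong[OF eq, of 0] by simp
    moreover have "f = g"
      using fun_cong[OF eq, of "Suc d" for d] by (intro ext) simp
    ultimately show "a = b \<and> f = g" ..
  qed
  have ne: "g \<noteq> (\<lambda>_. 0)" if "g \<in> colorings c D l" for g D l
    using that C by (auto simp: colorings_def)
  have eq: "colorings c C m = (\<lambda>(a, g). case_nat a g) ` (if card C \<le> m then U \<union> V \<union> W else {})"
  proof (intro set_eqI)
    fix f :: "nat \<Rightarrow> nat"
    define a g where "a = f 0" and "g = (\<lambda>d. f (Suc d))"
    have f: "f = case_nat a g"
      by (simp add: a_def g_def case_nat_eta)
    have "f \<in> (\<lambda>(a, g). case_nat a g) ` X \<longleftrightarrow> (a, g) \<in> X" for X
      unfolding f using inj_image_mem_iff[OF inj[of UNIV], of "(a, g)" X] by simp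
    moreover have "case_nat a g \<in> colorings c C m \<longleftrightarrow> card C \<le> m \<and> (a, g) \<in> U \<union> V \<union> W"
    proof (cases "g = (\<lambda>_. 0)")
      case True
      then show ?thesis
        using case_nat_zero_colorings[OF C, of a m] ne by (auto simp: U_def V_def W_def)
    next
      case False
      then show ?thesis
        using case_nat_colorings[OF C False, of a m] by (auto simp: U_def V_def W_def)
    qed
    ultimately show "f \<in> colorings c C m \<longleftrightarrow>
        f \<in> (\<lambda>(a, g). case_nat a g) ` (if card C \<le> m then U \<union> V \<union> W else {})"
      using f by auto
  qed
  show ?case
  proof (cases "card C \<le> m")
    case False
    then show ?thesis
      using eq k by (simp add: run_count.simps(2))
  next
    case True
    then have lt: "m - card C < m"
      using k by simp
    have U: "finite U" "card U = (k + 2) * (fact k * run_count (Suc k) (m - card C))"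
      using less.IH[OF lt C] C k by (auto simp: U_def card_cartesian_product)
    have V': "finite (colorings c (C - {a}) (m - card C))"
      "card (colorings c (C - {a}) (m - card C)) = fact (k - 1) * run_count k (m - card C)"
      if "a \<in> C - {c}" for a
      using less.IH[OF lt, of "C - {a}"] that C k by auto
    have V: "finite V" "card V = k * (fact (k - 1) * run_count k (m - card C))"
      using V' C k by (auto simp: V_def card_SigmaI)
    have W: "finite W" "card W = (if k = 0 then run_count 0 (m - card C) else 0)"
    proof -
      show "finite W"
        by (simp add: W_def)
      have "k = 0 \<longleftrightarrow> C = {c}"
        using k C by (auto simp: card_1_singleton_iff)
      then show "card W = (if k = 0 then run_count 0 (m - card C) else 0)"
        using True k by (auto simp: W_def)
    qed
    have "k * fact (k - 1) = (fact k :: nat)" if "k > 0"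
      using that by (simp add: fact_reduce)
    then have VW: "card V + card W = fact k * run_count k (m - card C)"
      unfolding V(2) W(2) by (cases "k = 0") (auto simp flip: mult.assoc)
    have disj: "U \<inter> V = {}" "(U \<union> V) \<inter> W = {}"
    proof -
      show "U \<inter> V = {}"
      proof (rule ccontr)
        assume "U \<inter> V \<noteq> {}"
        then obtain a g where a: "a \<in> C" and g: "g \<in> colorings c C (m - card C)"
          "g \<in> colorings c (C - {a}) (m - card C)"
          by (auto simp: U_def V_def)
        then have "C \<subseteq> range g" "range g \<subseteq> insert 0 (C - {a})"
          using colorings_range by metis+
        then have "a \<in> insert 0 (C - {a})"
          using a by (meson subsetD)
        then show False
          using a C(2) by auto
      qed
      show "(U \<union> V) \<inter> W = {}"
        using ne by (auto simp: U_def V_def W_def)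
    qed
    have "card (U \<union> V \<union> W) = card U + (card V + card W)"
      using U(1) V(1) W(1) disj by (simp add: card_Un_disjoint)
    also have "\<dots> = fact k * run_count (Suc k) m"
      unfolding VW U(2) using True k by (simp add: run_count.simps(2) algebra_simps)
    finally have "card (U \<union> V \<union> W) = fact k * run_count (Suc k) m" .
    moreover have "finite (U \<union> V \<union> W)"
      using U(1) V(1) W(1) by simp
    ultimately show ?thesis
      unfolding eq using True k inj by (simp add: card_image)
  qed
qed

section \<open>From colorings to lists of runs\<close>

lemma hd_run: "is_run xs \<Longrightarrow> hd xs = Max (set xs)"
proof (cases xs)
  case (Cons x ys)
  assume "is_run xs"
  then have "Max (set xs) = hd xs"
    using Cons by (intro Max_eqI) (auto intro: less_imp_le)
  then show ?thesis
    by simp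
qed simp

lemma run_sorted_list_of_set: "is_run xs \<Longrightarrow> rev (sorted_list_of_set (set xs)) = xs"
proof -
  assume "is_run xs"
  then have "sorted_wrt (<) (rev xs)" "distinct xs"
    by (auto simp: sorted_wrt_rev) (metis distinct_rev rev_rev_ident sorted_wrt_rev strict_sorted_iff)
  then have "sorted_list_of_set (set xs) = rev xs"
    by (metis List.finite_set card_set distinct_card length_rev set_rev sorted_list_of_set_unique)
  then show ?thesis
    by simp
qed

lemma distinct_concat_nth:
  assumes "distinct (concat xs)" "i < length xs" "j < length xs" "d \<in> set (xs ! i)" "d \<in> set (xs ! j)"
  shows "i = j"
  using assms
proof (induction xs arbitrary: i j)
  case (Cons x xs)
  show ?case
  proof (cases i; cases j)
    fix i' assume "i = Suc i'" "j = 0"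
    then have "d \<in> set (concat xs)" "d \<in> set x"
      using Cons.prems by (auto intro: nth_mem)
    then show ?thesis
      using Cons.prems(1) by auto
  next
    fix j' assume "i = 0" "j = Suc j'"
    then have "d \<in> set (concat xs)" "d \<in> set x"
      using Cons.prems by (auto intro: nth_mem)
    then show ?thesis
      using Cons.prems(1) by auto
  next
    fix i' j' assume "i = Suc i'" "j = Suc j'"
    then show ?thesis
      using Cons.IH[of i' j'] Cons.prems by auto
  qed auto
qed simp

lemma sum_list_eq_sum: "length xs = t \<Longrightarrow> (\<Sum>x\<leftarrow>xs. Suc (hd x)) = (\<Sum>i<t. Suc (hd (xs ! i)))"
  by (simp add: sum_list_sum_nth atLeast0LessThan)

text \<open>Run \<open>i\<close> lists the class of the label \<open>Suc i\<close> in decreasing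
  order, so its head is the maximum of the class; the last nonzero entry of the coloring is then the
  head of run \<open>c\<close>.\<close>

lemma bij_betw_colorings_runs:
  assumes c: "c < t"
  shows "bij_betw (\<lambda>f. map (\<lambda>i. rev (sorted_list_of_set {d. f d = Suc i})) [0..<t])
    (colorings (Suc c) {1..t} m) (peaked_run_lists c t m)"
  unfolding bij_betw_def
proof
  define h where "h f = map (\<lambda>i. rev (sorted_list_of_set {d. f d = Suc i})) [0..<t]"
    for f :: "nat \<Rightarrow> nat"
  have fin: "finite {d. f d = Suc i}" if "f \<in> colorings (Suc c) {1..t} m" for f i
    using that finite_color_class[of _ f "Suc i"] by (auto simp: colorings_def)
  have nth: "h f ! i = rev (sorted_list_of_set {d. f d = Suc i})" if "i < t" for f i
    using that by (simp add: h_def)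
  have setnth: "set (h f ! i) = {d. f d = Suc i}" if "f \<in> colorings (Suc c) {1..t} m" "i < t" for f i
    using nth[OF that(2)] fin[OF that(1)] by simp
  show "inj_on h (colorings (Suc c) {1..t} m)"
  proof (rule inj_onI)
    fix f g assume f: "f \<in> colorings (Suc c) {1..t} m" and g: "g \<in> colorings (Suc c) {1..t} m"
      and eq: "h f = h g"
    have fg: "f d = Suc i \<longleftrightarrow> g d = Suc i" if "i < t" for d i
      using setnth[OF f that] setnth[OF g that] eq by auto
    show "f = g"
    proof
      fix d
      have "f d \<in> insert 0 {1..t}" "g d \<in> insert 0 {1..t}"
        using colorings_range(1)[OF f] colorings_range(1)[OF g] by blast+
      then have "f d \<le> t" "g d \<le> t"
        by auto
      then show "f d = g d"
        using fg[of "f d - 1" d] fg[of "g d - 1" d] by (cases "f d"; cases "g d") auto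
    qed
  qed
  show "h ` colorings (Suc c) {1..t} m = peaked_run_lists c t m"
  proof (intro equalityI subsetI)
    fix xs assume "xs \<in> h ` colorings (Suc c) {1..t} m"
    then obtain f where f: "f \<in> colorings (Suc c) {1..t} m" and xs: "xs = h f"
      by blast
    have xlen: "length xs = t"
      by (simp add: xs h_def)
    have run: "is_run (xs ! i)" if "i < t" for i
    proof -
      have "Suc i \<in> range f"
        using f that by (auto simp: colorings_def)
      then have "set (xs ! i) \<noteq> {}"
        using setnth[OF f that] xs by auto
      then show ?thesis
        using nth[OF that, of f] xs by (auto simp: sorted_wrt_rev)
    qed
    have hd: "hd (xs ! i) = Max {d. f d = Suc i}" if "i < t" for i
      using hd_run[OF run[OF that]] setnth[OF f that] xs by simp
    have "distinct (concat xs)"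
    proof (rule distinct_concat)
      show "distinct xs"
        unfolding distinct_conv_nth
      proof (intro allI impI notI)
        fix i j assume ij: "i < length xs" "j < length xs" "i \<noteq> j" "xs ! i = xs ! j"
        then have t: "i < t" "j < t"
          using xlen by auto
        then obtain d where "d \<in> set (xs ! i)"
          using run hd_in_set by blast
        then have "f d = Suc i" "f d = Suc j"
          using ij(4) setnth[OF f t(1)] setnth[OF f t(2)] xs by auto
        then show False
          using ij(3) by simp
      qed
      show "distinct ys" if ys: "ys \<in> set xs" for ys
      proof -
        obtain i where "i < t" "ys = h f ! i"
          using ys xlen unfolding xs by (metis in_set_conv_nth)
        then show ?thesis
          using nth[of i f] by simp
      qed
      show "set ys \<inter> set zs = {}" if yz: "ys \<in> set xs" "zs \<in> set xs" "ys \<noteq> zs" for ys zs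
      proof -
        obtain i j where "i < t" "ys = xs ! i" "j < t" "zs = xs ! j"
          using yz(1,2) xlen by (metis in_set_conv_nth)
        then show ?thesis
          using yz(3) setnth[OF f, of i] setnth[OF f, of j] xs by auto
      qed
    qed
    moreover have "\<forall>x \<in> set xs. is_run x"
      using run xlen by (metis in_set_conv_nth)
    moreover have "(\<Sum>x\<leftarrow>xs. Suc (hd x)) = m"
    proof -
      have "(\<Sum>x\<leftarrow>xs. Suc (hd x)) = (\<Sum>i<t. Suc (Max {d. f d = Suc i}))"
        using sum_list_eq_sum[of xs t] xlen hd by simp
      also have "\<dots> = (\<Sum>i\<in>{1..t}. Suc (Max {d. f d = i}))"
        by (simp add: sum.atLeast1_atMost_eq)
      finally show ?thesis
        using f by (simp add: colorings_def)
    qed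
    moreover have "hd x \<le> hd (xs ! c)" if x: "x \<in> set xs" for x
    proof -
      obtain i where i: "i < t" "x = xs ! i"
        using x xlen by (metis in_set_conv_nth)
      obtain d where d: "f d = Suc c" "\<forall>e > d. f e = 0"
        using f unfolding colorings_def by blast
      have "f (hd x) = Suc i"
        using run[OF i(1)] setnth[OF f i(1)] xs i(2) hd_in_set by blast
      then have "hd x \<le> d"
        using d(2) by (metis leI nat.distinct(1))
      also have "d \<le> Max {d. f d = Suc c}"
        using d(1) fin[OF f] by (intro Max_ge) auto
      finally show ?thesis
        using hd[OF c] by simp
    qed
    ultimately show "xs \<in> peaked_run_lists c t m"
      using xlen by (auto simp: peaked_run_lists_def run_lists_def)
  next
    fix xs assume "xs \<in> peaked_run_lists c t m"
    then have xs: "length xs = t" "\<And>i. i < t \<Longrightarrow> is_run (xs ! i)" "distinct (concat xs)"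
      "(\<Sum>x\<leftarrow>xs. Suc (hd x)) = m" "\<And>i. i < t \<Longrightarrow> hd (xs ! i) \<le> hd (xs ! c)"
      by (auto simp: peaked_run_lists_def run_lists_def)
    \<comment> \<open>The choice is unambiguous, since a number lies in at most one of the disjoint
      runs.\<close>
    define f where "f d = (if \<exists>i<t. d \<in> set (xs ! i) then Suc (SOME i. i < t \<and> d \<in> set (xs ! i)) else 0)"
      for d
    have f: "f d = Suc i \<longleftrightarrow> i < t \<and> d \<in> set (xs ! i)" for d i
    proof
      assume "f d = Suc i"
      then have "\<exists>i. i < t \<and> d \<in> set (xs ! i)" "i = (SOME i. i < t \<and> d \<in> set (xs ! i))"
        by (auto simp: f_def split: if_splits)
      then show "i < t \<and> d \<in> set (xs ! i)"
        using someI_ex[of "\<lambda>i. i < t \<and> d \<in> set (xs ! i)"] by simp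
    next
      assume i: "i < t \<and> d \<in> set (xs ! i)"
      then have "(SOME i. i < t \<and> d \<in> set (xs ! i)) = i"
        by (intro some_equality) (use distinct_concat_nth[OF xs(3)] xs(1) in auto)
      then show "f d = Suc i"
        using i by (auto simp: f_def)
    qed
    have cl: "{d. f d = Suc i} = set (xs ! i)" if "i < t" for i
      using f that by auto
    have "h f = xs"
    proof (rule nth_equalityI)
      fix i assume "i < length (h f)"
      then have "i < t"
        by (simp add: h_def)
      then show "h f ! i = xs ! i"
        using nth[of i f] cl run_sorted_list_of_set[OF xs(2)] by simp
    qed (simp add: h_def xs(1))
    moreover have "f \<in> colorings (Suc c) {1..t} m"
    proof -
      have "f d \<in> insert 0 {1..t}" for d
        using f[of d "f d - 1"] by (cases "f d") auto
      then have "range f \<subseteq> insert 0 {1..t}"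
        by (intro image_subsetI)
      moreover have "i \<in> range f" if "i \<in> {1..t}" for i
      proof -
        obtain k where k: "i = Suc k" "k < t"
          using \<open>i \<in> {1..t}\<close> by (cases i) auto
        then have "f (hd (xs ! k)) = i"
          using xs(2)[of k] by (simp add: f)
        then show ?thesis
          by (metis rangeI)
      qed
      moreover have "f (hd (xs ! c)) = Suc c"
        using xs(2)[OF c] c by (auto simp: f)
      moreover have "f e = 0" if e: "e > hd (xs ! c)" for e
      proof (rule ccontr)
        assume "f e \<noteq> 0"
        then obtain i where "f e = Suc i"
          by (cases "f e") auto
        then have i: "i < t" "e \<in> set (xs ! i)"
          using f by auto
        then have "e \<le> hd (xs ! i)"
          using hd_run[OF xs(2)] by simp
        then show False
          using xs(5)[OF i(1)] e by simp
      qed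
      moreover have "(\<Sum>i\<in>{1..t}. Suc (Max {d. f d = i})) = m"
      proof -
        have "(\<Sum>i\<in>{1..t}. Suc (Max {d. f d = i})) = (\<Sum>i<t. Suc (Max {d. f d = Suc i}))"
          by (simp add: sum.atLeast1_atMost_eq)
        also have "\<dots> = (\<Sum>i<t. Suc (hd (xs ! i)))"
          using cl hd_run[OF xs(2)] by simp
        also have "\<dots> = m"
          using sum_list_eq_sum[OF xs(1)] xs(4) by simp
        finally show ?thesis .
      qed
      ultimately show ?thesis
        unfolding colorings_def mem_Collect_eq by (intro conjI subsetI exI[of _ "hd (xs ! c)"]) auto
    qed
    ultimately show "xs \<in> h ` colorings (Suc c) {1..t} m"
      by blast
  qed
qed

lemma card_peaked_run_lists:
  assumes "c < t"
  shows "finite (peaked_run_lists c t m)"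
    "card (peaked_run_lists c t m) = fact (t - 1) * run_count t m"
proof -
  have "finite (colorings (Suc c) {1..t} m)"
    "card (colorings (Suc c) {1..t} m) = fact (t - 1) * run_count t m"
    using card_colorings[of "{1..t}" "Suc c" m] assms by auto
  then show "finite (peaked_run_lists c t m)"
    "card (peaked_run_lists c t m) = fact (t - 1) * run_count t m"
    using bij_betw_colorings_runs[OF assms, of m] bij_betw_same_card bij_betw_finite by metis+
qed

text \<open>The largest number lies in exactly one of the \<open>t\<close> runs; its position
  partitions the run lists into \<open>t\<close> classes of equal size.\<close>

lemma card_run_lists:
  assumes "t > 0"
  shows "finite (run_lists t m)" "card (run_lists t m) = fact t * run_count t m"
proof -
  have eq: "run_lists t m = (\<Union>c<t. peaked_run_lists c t m)"
  proof (intro equalityI subsetI)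
    fix xs assume xs: "xs \<in> run_lists t m"
    then have len: "length xs = t"
      by (simp add: run_lists_def)
    obtain c where c: "c < t" "\<And>i. i < t \<Longrightarrow> hd (xs ! i) \<le> hd (xs ! c)"
    proof -
      have "Max ((\<lambda>i. hd (xs ! i)) ` {..<t}) \<in> (\<lambda>i. hd (xs ! i)) ` {..<t}"
        using assms by (intro Max_in) auto
      then obtain c where "c < t" "Max ((\<lambda>i. hd (xs ! i)) ` {..<t}) = hd (xs ! c)"
        by auto
      moreover have "hd (xs ! i) \<le> Max ((\<lambda>i. hd (xs ! i)) ` {..<t})" if "i < t" for i
        using that by (intro Max_ge) auto
      ultimately show ?thesis
        using that by metis
    qed
    have "\<forall>x \<in> set xs. hd x \<le> hd (xs ! c)"
      using c(2) len by (metis in_set_conv_nth)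
    then show "xs \<in> (\<Union>c<t. peaked_run_lists c t m)"
      using xs c(1) by (auto simp: peaked_run_lists_def)
  qed (auto simp: peaked_run_lists_def)
  show "finite (run_lists t m)"
    unfolding eq using card_peaked_run_lists by blast
  have disj: "peaked_run_lists c t m \<inter> peaked_run_lists c' t m = {}" if "c < t" "c' < t" "c \<noteq> c'" for c c'
  proof (rule ccontr)
    assume "peaked_run_lists c t m \<inter> peaked_run_lists c' t m \<noteq> {}"
    then obtain xs where xs: "xs \<in> peaked_run_lists c t m" "xs \<in> peaked_run_lists c' t m"
      by blast
    then have len: "length xs = t" and d: "distinct (concat xs)" and r: "\<forall>x \<in> set xs. is_run x"
      by (auto simp: peaked_run_lists_def run_lists_def)
    have "hd (xs ! c) = hd (xs ! c')"
      using xs that len by (simp add: peaked_run_lists_def le_antisym)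
    moreover have "hd (xs ! c) \<in> set (xs ! c)" "hd (xs ! c') \<in> set (xs ! c')"
      using r that len by simp_all
    ultimately show False
      using distinct_concat_nth[OF d] that len by metis
  qed
  have "card (run_lists t m) = (\<Sum>c<t. card (peaked_run_lists c t m))"
    unfolding eq using card_peaked_run_lists disj by (intro card_UN_disjoint) auto
  also have "\<dots> = t * (fact (t - 1) * run_count t m)"
    using card_peaked_run_lists by simp
  also have "\<dots> = fact t * run_count t m"
    using assms by (simp add: fact_reduce)
  finally show "card (run_lists t m) = fact t * run_count t m" .
qed

lemma card_rooted_cycles:
  "finite (rooted_cycles R n)"
  "card (rooted_cycles R n) = (\<Sum>t\<in>{1..n}. \<Sum>j\<in>{j. j \<le> n \<and> R j (n - j)}.
     fact (t - 1) * fact t * (run_count t (n - j) * run_count t j))"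
proof -
  let ?I = "SIGMA t:{1..n}. SIGMA j:{j. j \<le> n \<and> R j (n - j)}.
    peaked_run_lists 0 t (n - j) \<times> run_lists t j"
  have fin: "finite (SIGMA j:{j. j \<le> n \<and> R j (n - j)}. peaked_run_lists 0 t (n - j) \<times> run_lists t j)"
    if "t \<in> {1..n}" for t
    using that card_peaked_run_lists(1) card_run_lists(1) by (intro finite_SigmaI) auto
  then have "finite ?I"
    by (intro finite_SigmaI[OF finite_atLeastAtMost])
  moreover have "card ?I = (\<Sum>t\<in>{1..n}. \<Sum>j\<in>{j. j \<le> n \<and> R j (n - j)}.
      fact (t - 1) * fact t * (run_count t (n - j) * run_count t j))"
  proof -
    have "card ?I = (\<Sum>t\<in>{1..n}. card (SIGMA j:{j. j \<le> n \<and> R j (n - j)}.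
        peaked_run_lists 0 t (n - j) \<times> run_lists t j))"
      using fin by (intro card_SigmaI) auto
    also have "\<dots> = (\<Sum>t\<in>{1..n}. \<Sum>j\<in>{j. j \<le> n \<and> R j (n - j)}.
        card (peaked_run_lists 0 t (n - j) \<times> run_lists t j))"
      using card_peaked_run_lists(1) card_run_lists(1)
      by (intro sum.cong refl card_SigmaI) auto
    also have "\<dots> = (\<Sum>t\<in>{1..n}. \<Sum>j\<in>{j. j \<le> n \<and> R j (n - j)}.
        fact (t - 1) * fact t * (run_count t (n - j) * run_count t j))"
      using card_peaked_run_lists(2) card_run_lists(2)
      by (intro sum.cong refl) (auto simp: card_cartesian_product)
    finally show ?thesis .
  qed
  moreover have "bij_betw (\<lambda>(t, j, xs, ys). join_runs (zip xs ys)) ?I (rooted_cycles R n)"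
    by (rule bij_betw_rooted_cycles)
  ultimately show "finite (rooted_cycles R n)"
    "card (rooted_cycles R n) = (\<Sum>t\<in>{1..n}. \<Sum>j\<in>{j. j \<le> n \<and> R j (n - j)}.
     fact (t - 1) * fact t * (run_count t (n - j) * run_count t j))"
    by (simp_all add: bij_betw_finite flip: bij_betw_same_card)
qed

section \<open>Asymptotics\<close>

definition run_density :: "nat \<Rightarrow> nat \<Rightarrow> real" where
  "run_density t m = real (run_count t m) / 2 ^ m"

definition limit_density :: "nat \<Rightarrow> real" where
  "limit_density t = juggling_q t / fact (t - 1)"

lemma Suc_less_two_power: "t \<ge> 2 \<Longrightarrow> real t + 1 < 2 ^ t"
proof (induction t rule: nat_induct_at_least)
  case (Suc t)
  then show ?case by simp
qed simp

lemma juggling_q_Suc: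
  "t \<ge> 1 \<Longrightarrow> juggling_q (Suc t) = juggling_q t * (real t / (2 ^ Suc t - real t - 2))"
  by (simp add: juggling_q_def algebra_simps)

lemma juggling_q_1: "juggling_q (Suc 0) = 1 / 2"
  by (simp add: juggling_q_def)

lemma juggling_q_pos: "juggling_q t > 0"
  unfolding juggling_q_def using Suc_less_two_power
  by (intro mult_pos_pos prod_pos divide_pos_pos) fastforce+

lemma limit_density_pos: "limit_density t > 0"
  by (simp add: limit_density_def juggling_q_pos)

text \<open>This is the fixed-point equation of \<open>run_density_add\<close> with the term
  \<open>(real t + 2) * limit_density (Suc t)\<close> moved to the left.\<close>

lemma limit_density_Suc:
  assumes "t \<ge> 1"
  shows "(2 ^ Suc t - real (Suc t) - 1) * limit_density (Suc t) = limit_density t"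
proof -
  define D where "D = 2 ^ Suc t - real t - 2"
  have D: "D \<noteq> 0" "2 ^ Suc t - real (Suc t) - 1 = D"
    using Suc_less_two_power[of "Suc t"] assms by (simp_all add: D_def)
  have "(fact t :: real) = real t * fact (t - 1)"
    using assms by (simp add: fact_reduce)
  then have "limit_density (Suc t) = limit_density t / D"
    using assms juggling_q_Suc[OF assms] by (simp add: limit_density_def D_def)
  then show ?thesis
    unfolding D(2) using D(1) by simp
qed

lemma run_density_nonneg: "run_density t m \<ge> 0"
  by (simp add: run_density_def)

lemma run_density_less: "m < Suc t \<Longrightarrow> run_density (Suc t) m = 0"
  by (simp add: run_density_def run_count.simps(2))

lemma run_density_add:
  "run_density (Suc t) (m + Suc t) =
     ((real t + 2) * run_density (Suc t) m + run_density t m) / 2 ^ Suc t"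
  by (simp add: run_density_def run_count.simps(2) power_add field_simps)

lemma run_density_1: "run_density (Suc 0) m = (if m = 0 then 0 else 1 / 2)"
proof -
  have "run_count (Suc 0) (Suc m) = 2 ^ m" for m
    by (induction m) (auto simp: run_count.simps(2))
  then show ?thesis
    by (cases m) (auto simp: run_density_def run_count.simps(2))
qed

text \<open>
  The recursion makes the densities nondecreasing and bounded by the fixed point of its limit,
  which gives both the limit and a bound that is uniform in the total length of the runs.
\<close>

lemma run_density_props:
  assumes "t \<ge> 1"
  shows "incseq (run_density t) \<and> (\<forall>m. run_density t m \<le> limit_density t) \<and>
    run_density t \<longlonglongrightarrow> limit_density t"
  using assms
proof (induction t rule: nat_induct_at_least)
  case base
  have "(\<lambda>m. run_density 1 (Suc m)) \<longlonglongrightarrow> 1 / 2"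
    by (simp add: run_density_1)
  then have "run_density 1 \<longlonglongrightarrow> 1 / 2"
    by (rule LIMSEQ_imp_Suc)
  moreover have "limit_density 1 = 1 / 2"
    by (simp add: limit_density_def juggling_q_1)
  moreover have "incseq (run_density 1)"
    by (auto simp: run_density_1 incseq_def)
  moreover have "run_density 1 m \<le> 1 / 2" for m
    by (simp add: run_density_1)
  ultimately show ?case
    by (metis (full_types))
next
  case (Suc t)
  let ?d = "run_density (Suc t)" and ?l = "limit_density (Suc t)"
  have IH: "incseq (run_density t)" "run_density t m \<le> limit_density t"
    "run_density t \<longlonglongrightarrow> limit_density t" for m
    using Suc.IH by auto
  have fixp: "((real t + 2) * ?l + limit_density t) / 2 ^ Suc t = ?l"
    using limit_density_Suc[OF Suc.hyps] by (simp add: field_simps)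
  have "?d m \<le> ?d (Suc m)" for m
  proof (induction m rule: less_induct)
    case (less m)
    show ?case
    proof (cases "m < Suc t")
      case False
      then obtain k where k: "m = k + Suc t"
        by (metis add.commute le_Suc_ex not_less)
      have "?d k \<le> ?d (Suc k)" "run_density t k \<le> run_density t (Suc k)"
        using less k IH(1) by (auto simp: incseq_SucD)
      then have "?d (k + Suc t) \<le> ?d (Suc k + Suc t)"
        unfolding run_density_add by (intro divide_right_mono add_mono mult_left_mono) auto
      then show ?thesis
        using k by simp
    qed (simp add: run_density_less run_density_nonneg)
  qed
  then have inc: "incseq ?d"
    by (rule incseq_SucI)
  have bound: "?d m \<le> ?l" for m
  proof (induction m rule: less_induct)
    case (less m)
    show ?case
    proof (cases "m < Suc t")
      case False
      then obtain k where k: "m = k + Suc t"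
        by (metis add.commute le_Suc_ex not_less)
      have "?d (k + Suc t) \<le> ((real t + 2) * ?l + limit_density t) / 2 ^ Suc t"
        unfolding run_density_add using less k IH(2)
        by (intro divide_right_mono add_mono mult_left_mono) auto
      then show ?thesis
        using k fixp by simp
    qed (simp add: run_density_less less_imp_le[OF limit_density_pos])
  qed
  obtain L where L: "?d \<longlonglongrightarrow> L"
    using incseq_convergent[OF inc] bound by metis
  \<comment> \<open>The limit exists by monotonicity and boundedness. Passing to it in the recursion
    gives a linear equation with nonzero coefficient, which identifies it.\<close>
  have "(\<lambda>m. ?d (m + Suc t)) \<longlonglongrightarrow> ((real t + 2) * L + limit_density t) / 2 ^ Suc t"
    unfolding run_density_add by (intro tendsto_intros L IH(3)) auto
  moreover have "(\<lambda>m. ?d (m + Suc t)) \<longlonglongrightarrow> L"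
    using L by (rule LIMSEQ_ignore_initial_segment)
  ultimately have "L = ((real t + 2) * L + limit_density t) / 2 ^ Suc t"
    using LIMSEQ_unique by blast
  then have "(2 ^ Suc t - real (Suc t) - 1) * L = limit_density t"
    by (simp add: field_simps)
  then have "(2 ^ Suc t - real (Suc t) - 1) * L = (2 ^ Suc t - real (Suc t) - 1) * ?l"
    using limit_density_Suc[OF Suc.hyps] by simp
  moreover have "2 ^ Suc t - real (Suc t) - 1 \<noteq> 0"
    using Suc_less_two_power[of "Suc t"] Suc.hyps by simp
  ultimately have "L = ?l"
    by (simp only: mult_cancel_left) simp
  then show ?case
    using inc bound L by blast
qed

section \<open>The series defining the constant\<close>

abbreviation (input) gamma_term :: "nat \<Rightarrow> real" where
  "gamma_term t \<equiv> real t * (juggling_q t)\<^sup>2"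

lemma gamma_term_eq: "t \<ge> 1 \<Longrightarrow> fact (t - 1) * fact t * (limit_density t)\<^sup>2 = gamma_term t"
  by (cases t) (simp_all add: limit_density_def power2_eq_square field_simps)

text \<open>From \<open>t = 2\<close> on, the quotient of consecutive values of
  \<open>juggling_q\<close> is at most 1/2. Squaring gives 1/4, and
  \<open>real (Suc t) \<le> 2 * real t\<close> costs a factor 2.\<close>

lemma gamma_term_Suc:
  assumes "t \<ge> 2"
  shows "gamma_term (Suc t) \<le> 1 / 2 * gamma_term t"
proof -
  \<comment> \<open>This is the bound 1/2 on the quotient with denominators cleared; it is an
    equality at \<open>t = 2\<close>.\<close>
  have "3 * real t + 2 \<le> 2 ^ Suc t"
    using assms
  proof (induction t rule: nat_induct_at_least)
    case (Suc t)
    then show ?case by simp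
  qed simp
  then have "real t / (2 ^ Suc t - real t - 2) \<le> 1 / 2" "0 \<le> real t / (2 ^ Suc t - real t - 2)"
    using assms by (simp_all add: field_simps)
  then have "juggling_q (Suc t) \<le> juggling_q t * (1 / 2)"
    using assms juggling_q_Suc[of t] juggling_q_pos[of t] by (simp only:) (intro mult_left_mono, auto)
  then have "(juggling_q (Suc t))\<^sup>2 \<le> (juggling_q t * (1 / 2))\<^sup>2"
    using juggling_q_pos by (intro power_mono) (auto intro: less_imp_le)
  then have "gamma_term (Suc t) \<le> (2 * real t) * (juggling_q t * (1 / 2))\<^sup>2"
    using assms by (intro mult_mono) auto
  then show ?thesis
    by (simp add: power2_eq_square mult_ac)
qed

lemma summable_gamma_term: "summable gamma_term"
  using gamma_term_Suc by (intro summable_ratio_test[of "1 / 2" 2]) auto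

text \<open>The term at 0 vanishes, so the series over all naturals has the same sum as the one over
  \<open>{1..}\<close>.\<close>

lemma has_sum_gamma_term: "(gamma_term has_sum (\<Sum>t. gamma_term t)) {1..}"
proof -
  have "(gamma_term has_sum (\<Sum>t. gamma_term t)) UNIV"
    using summable_gamma_term by (intro norm_summable_imp_has_sum summable_sums) auto
  moreover have "t = 0" if "t \<notin> {1..}" for t :: nat
    using that by simp
  ultimately show ?thesis
    using has_sum_cong_neutral[of "{1..}" UNIV gamma_term gamma_term] by auto
qed

lemma gamma_C'_eq: "gamma_C' = (\<Sum>t. gamma_term t) / 2"
  using infsumI[OF has_sum_gamma_term] by (simp add: gamma_C'_def)

lemma sum_gamma_term_le: "finite A \<Longrightarrow> (\<Sum>t\<in>A. gamma_term t) \<le> 2 * gamma_C'"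
  unfolding gamma_C'_eq using summable_gamma_term by (simp add: sum_le_suminf)

lemma gamma_C'_pos: "gamma_C' > 0"
  using sum_gamma_term_le[of "{1}"] by (simp add: juggling_q_1 power2_eq_square)

text \<open>The terms up to \<open>t = 6\<close> are computed exactly, and the rest is dominated by
  a geometric series of ratio 1/2 starting from the term at 7. The constant is about 0.4783251, so
  most of the tolerance is used up and the sixth term is still significant.\<close>

lemma gamma_C'_bounds: "\<bar>gamma_C' - 0.478326\<bar> < 1 / 10 ^ 6"
proof -
  have q: "juggling_q 2 = 1 / 2" "juggling_q 3 = 1 / 4" "juggling_q 4 = 3 / 44"
    "juggling_q 5 = 3 / 286" "juggling_q 6 = 5 / 5434" "juggling_q 7 = 1 / 21736"
    using juggling_q_Suc[of 1] juggling_q_Suc[of 2] juggling_q_Suc[of 3] juggling_q_Suc[of 4]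
      juggling_q_Suc[of 5] juggling_q_Suc[of 6] juggling_q_1
    by (simp_all add: eval_nat_numeral)
  define S where "S = (\<Sum>t<7. gamma_term t)"
  have S: "S = 1 / 4 + 2 * (1 / 2)\<^sup>2 + 3 * (1 / 4)\<^sup>2 + 4 * (3 / 44)\<^sup>2 + 5 * (3 / 286)\<^sup>2 + 6 * (5 / 5434)\<^sup>2"
  proof -
    have "{..<7} = {0, 1, 2, 3, 4, 5, 6 :: nat}"
      by auto
    then show ?thesis
      by (simp add: S_def q juggling_q_1 power2_eq_square)
  qed
  have "S \<le> 2 * gamma_C'"
    unfolding S_def by (rule sum_gamma_term_le) simp
  moreover have "2 * gamma_C' \<le> S + 2 * (7 * (1 / 21736)\<^sup>2)"
  proof -
    have le: "gamma_term (k + 7) \<le> 7 * (1 / 21736)\<^sup>2 * (1 / 2) ^ k" for k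
    proof (induction k)
      case (Suc k)
      then show ?case
        using gamma_term_Suc[of "k + 7"] by simp
    qed (simp add: q)
    have s: "summable (\<lambda>k. gamma_term (k + 7))"
      using summable_gamma_term by (rule summable_ignore_initial_segment)
    have g: "(\<lambda>k. 7 * (1 / 21736)\<^sup>2 * (1 / 2 :: real) ^ k) sums (7 * (1 / 21736)\<^sup>2 * 2)"
      using sums_mult[OF geometric_sums[of "1 / 2 :: real"], of "7 * (1 / 21736)\<^sup>2"] by simp
    have "(\<Sum>k. gamma_term (k + 7)) \<le> 7 * (1 / 21736)\<^sup>2 * 2"
      using suminf_le[OF le s sums_summable[OF g]] sums_unique[OF g] by simp
    then show ?thesis
      using suminf_split_initial_segment[OF summable_gamma_term, of 7]
      by (simp add: gamma_C'_eq S_def)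
  qed
  ultimately show ?thesis
    unfolding S by (simp add: abs_less_iff power2_eq_square)
qed

section \<open>Upper and lower bounds for the number of patterns\<close>

lemma num_patterns_upper:
  "real (num_colored_prime_patterns n) \<le> gamma_C' * (real n + 2) * 2 ^ n"
proof -
  define J where "J = {j. j \<le> n \<and> j \<le> n - j}"
  \<comment> \<open>There are \<open>n div 2 + 1\<close> admissible blue totals, which is where
    \<open>(n + 2) / 2\<close> comes from.\<close>
  have "J = {..n div 2}"
    by (auto simp: J_def)
  then have "2 * card J \<le> n + 2"
    by simp
  then have "real (2 * card J) \<le> real (n + 2)"
    by (simp only: of_nat_le_iff)
  then have cJ: "real (card J) \<le> (real n + 2) / 2"
    by simp
  \<comment> \<open>The two powers of 2 combine to \<open>2 ^ n\<close>, so the bound does not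
    depend on \<open>j\<close>, and it is summable over \<open>t\<close>.\<close>
  have le: "real (fact (t - 1) * fact t * (run_count t (n - j) * run_count t j))
      \<le> gamma_term t * 2 ^ n" if "t \<ge> 1" "j \<in> J" for t j
  proof -
    have d: "run_density t (n - j) * run_density t j \<le> limit_density t * limit_density t"
      using run_density_props[OF that(1)] run_density_nonneg
      by (intro mult_mono) (auto intro: less_imp_le[OF limit_density_pos])
    have "(2::real) ^ (n - j) * 2 ^ j = 2 ^ n"
      using that(2) by (simp add: J_def flip: power_add)
    then have "real (fact (t - 1) * fact t * (run_count t (n - j) * run_count t j))
        = fact (t - 1) * fact t * (run_density t (n - j) * run_density t j) * 2 ^ n"
      by (simp add: run_density_def field_simps)
    also have "\<dots> \<le> fact (t - 1) * fact t * (limit_density t * limit_density t) * 2 ^ n"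
      using d by (intro mult_right_mono mult_left_mono) auto
    also have "\<dots> = gamma_term t * 2 ^ n"
      using gamma_term_eq[OF that(1)] by (simp add: power2_eq_square)
    finally show ?thesis .
  qed
  have "real (num_colored_prime_patterns n) \<le> real (card (rooted_cycles (\<le>) n))"
    using num_colored_prime_patterns_bounds(2) card_rooted_cycles(1) by simp
  also have "\<dots> = (\<Sum>t\<in>{1..n}. \<Sum>j\<in>J.
      real (fact (t - 1) * fact t * (run_count t (n - j) * run_count t j)))"
    unfolding card_rooted_cycles(2) J_def by simp
  also have "\<dots> \<le> (\<Sum>t\<in>{1..n}. \<Sum>j\<in>J. gamma_term t * 2 ^ n)"
    using le by (intro sum_mono) auto
  also have "\<dots> = real (card J) * (\<Sum>t\<in>{1..n}. gamma_term t) * 2 ^ n"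
    by (simp add: sum_distrib_left sum_distrib_right mult_ac)
  also have "\<dots> \<le> (real n + 2) / 2 * (2 * gamma_C') * 2 ^ n"
    using cJ sum_gamma_term_le[of "{1..n}"]
    by (intro mult_right_mono mult_mono) (auto intro: sum_nonneg)
  also have "\<dots> = gamma_C' * (real n + 2) * 2 ^ n"
    by simp
  finally show ?thesis .
qed

text \<open>For \<open>j\<close> from \<open>M\<close> to just below \<open>n / 2\<close> both
  totals are at least \<open>M\<close>, so monotonicity bounds both densities from below by their
  value at \<open>M\<close>. With \<open>M\<close> fixed, only boundedly many of the roughly
  \<open>n / 2\<close> values of \<open>j\<close> are lost.\<close>

lemma num_patterns_lower:
  assumes "T \<le> n"
  shows "(real n / 2 - real M) * (\<Sum>t\<in>{1..T}. fact (t - 1) * fact t * (run_density t M)\<^sup>2) * 2 ^ n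
    \<le> real (num_colored_prime_patterns n)"
proof -
  define J where "J = {j. j \<le> n \<and> j < n - j}"
  \<comment> \<open>For natural numbers, \<open>j < (n + 1) div 2\<close> says exactly that
    \<open>2 * j < n\<close>.\<close>
  define K where "K = {M..<(n + 1) div 2}"
  have K: "K \<subseteq> J" "finite J"
    by (auto simp: J_def K_def)
  have "real n / 2 - real M \<le> real ((n + 1) div 2 - M)"
    by linarith
  then have cK: "real n / 2 - real M \<le> real (card K)"
    by (simp add: K_def)
  have le: "fact (t - 1) * fact t * (run_density t M)\<^sup>2 * 2 ^ n \<le>
      real (fact (t - 1) * fact t * (run_count t (n - j) * run_count t j))"
    if "t \<ge> 1" "j \<in> K" for t j
  proof -
    have j: "M \<le> j" "M \<le> n - j" "j \<le> n"
      using that(2) by (auto simp: K_def)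
    then have d: "run_density t M * run_density t M \<le> run_density t (n - j) * run_density t j"
      using run_density_props[OF that(1)] run_density_nonneg
      by (intro mult_mono) (auto simp: incseq_def)
    have "(2::real) ^ (n - j) * 2 ^ j = 2 ^ n"
      using j by (simp flip: power_add)
    then have "real (fact (t - 1) * fact t * (run_count t (n - j) * run_count t j))
        = fact (t - 1) * fact t * (run_density t (n - j) * run_density t j) * 2 ^ n"
      by (simp add: run_density_def field_simps)
    moreover have "\<dots> \<ge> fact (t - 1) * fact t * (run_density t M * run_density t M) * 2 ^ n"
      using d by (intro mult_right_mono mult_left_mono) auto
    ultimately show ?thesis
      by (simp add: power2_eq_square)
  qed
  let ?A = "\<Sum>t\<in>{1..T}. fact (t - 1) * fact t * (run_density t M)\<^sup>2"
  have "(real n / 2 - real M) * ?A * 2 ^ n \<le> real (card K) * ?A * 2 ^ n"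
    using cK by (intro mult_right_mono sum_nonneg) auto
  also have "\<dots> = (\<Sum>t\<in>{1..T}. \<Sum>j\<in>K. fact (t - 1) * fact t * (run_density t M)\<^sup>2 * 2 ^ n)"
    by (simp add: sum_distrib_left sum_distrib_right mult_ac)
  also have "\<dots> \<le> (\<Sum>t\<in>{1..T}. \<Sum>j\<in>K.
      real (fact (t - 1) * fact t * (run_count t (n - j) * run_count t j)))"
    using le by (intro sum_mono) auto
  also have "\<dots> \<le> (\<Sum>t\<in>{1..T}. \<Sum>j\<in>J.
      real (fact (t - 1) * fact t * (run_count t (n - j) * run_count t j)))"
    using K by (intro sum_mono sum_mono2) auto
  also have "\<dots> \<le> (\<Sum>t\<in>{1..n}. \<Sum>j\<in>J.
      real (fact (t - 1) * fact t * (run_count t (n - j) * run_count t j)))"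
    using assms by (intro sum_mono2 sum_nonneg) auto
  also have "\<dots> = real (card (rooted_cycles (<) n))"
    unfolding card_rooted_cycles(2) J_def by simp
  also have "\<dots> \<le> real (num_colored_prime_patterns n)"
    using num_colored_prime_patterns_bounds(1) card_rooted_cycles(1) by simp
  finally show ?thesis .
qed

text \<open>The cut-offs are chosen in turn: \<open>T\<close> makes a partial sum of the series
  exceed \<open>2 * a\<close>, and then, the sum being finite, \<open>M\<close> brings all its
  densities close enough to their limits.\<close>

lemma ex_density_sum_gt:
  assumes "a < gamma_C'"
  shows "\<exists>T M. a < (\<Sum>t\<in>{1..T}. fact (t - 1) * fact t * (run_density t M)\<^sup>2) / 2"
proof -
  have "(\<lambda>T. \<Sum>t<T. gamma_term t) \<longlonglongrightarrow> 2 * gamma_C'"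
    using summable_LIMSEQ[OF summable_gamma_term] by (simp add: gamma_C'_eq)
  then have "eventually (\<lambda>T. 2 * a < (\<Sum>t<T. gamma_term t)) sequentially"
    using assms by (intro order_tendstoD(1)) auto
  then obtain T where T: "2 * a < (\<Sum>t<Suc T. gamma_term t)"
    by (meson eventually_sequentially le_Suc_eq nle_le)
  have "(\<Sum>t<Suc T. gamma_term t) = (\<Sum>t\<in>{1..T}. gamma_term t)"
    unfolding lessThan_Suc_atMost by (intro sum.mono_neutral_right) auto
  moreover have "(\<lambda>M. \<Sum>t\<in>{1..T}. fact (t - 1) * fact t * (run_density t M)\<^sup>2) \<longlonglongrightarrow>
      (\<Sum>t\<in>{1..T}. fact (t - 1) * fact t * (limit_density t)\<^sup>2)"
    using run_density_props by (intro tendsto_intros) auto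
  moreover have "(\<Sum>t\<in>{1..T}. fact (t - 1) * fact t * (limit_density t)\<^sup>2)
      = (\<Sum>t\<in>{1..T}. gamma_term t)"
    using gamma_term_eq by (intro sum.cong) auto
  ultimately have "eventually (\<lambda>M. 2 * a <
      (\<Sum>t\<in>{1..T}. fact (t - 1) * fact t * (run_density t M)\<^sup>2)) sequentially"
    using T by (intro order_tendstoD(1)) auto
  then obtain M where "2 * a < (\<Sum>t\<in>{1..T}. fact (t - 1) * fact t * (run_density t M)\<^sup>2)"
    by (meson eventually_sequentially order_refl)
  then show ?thesis
    by (intro exI[of _ T] exI[of _ M]) simp
qed

lemma num_patterns_tendsto:
  "(\<lambda>n. real (num_colored_prime_patterns n) / (real n * 2 ^ n)) \<longlonglongrightarrow> gamma_C'"
proof (rule order_tendstoI)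
  fix a assume a: "a < gamma_C'"
  obtain T M where TM: "a < (\<Sum>t\<in>{1..T}. fact (t - 1) * fact t * (run_density t M)\<^sup>2) / 2"
    using ex_density_sum_gt[OF a] by blast
  define A where "A = (\<Sum>t\<in>{1..T}. fact (t - 1) * fact t * (run_density t M)\<^sup>2)"
  have "(\<lambda>n. A / 2 - real M * A / real n) \<longlonglongrightarrow> A / 2 - 0"
    by (intro tendsto_intros lim_const_over_n)
  then have "eventually (\<lambda>n. a < A / 2 - real M * A / real n) sequentially"
    using TM by (intro order_tendstoD(1)) (auto simp: A_def)
  then show "eventually (\<lambda>n. a < real (num_colored_prime_patterns n) / (real n * 2 ^ n)) sequentially"
    using eventually_ge_at_top[of T] eventually_gt_at_top[of 0]
  proof eventually_elim
    case (elim n)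
    have "A / 2 - real M * A / real n = (real n / 2 - real M) * A * 2 ^ n / (real n * 2 ^ n)"
      using elim(3) by (simp add: field_simps)
    also have "\<dots> \<le> real (num_colored_prime_patterns n) / (real n * 2 ^ n)"
      unfolding A_def by (intro divide_right_mono num_patterns_lower elim(2)) simp
    finally show ?case
      using elim(1) by linarith
  qed
next
  fix a assume a: "gamma_C' < a"
  have "(\<lambda>n. gamma_C' + 2 * gamma_C' / real n) \<longlonglongrightarrow> gamma_C' + 0"
    by (intro tendsto_intros lim_const_over_n)
  then have "eventually (\<lambda>n. gamma_C' + 2 * gamma_C' / real n < a) sequentially"
    using a by (intro order_tendstoD(2)) auto
  then show "eventually (\<lambda>n. real (num_colored_prime_patterns n) / (real n * 2 ^ n) < a) sequentially"
    using eventually_gt_at_top[of 0]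
  proof eventually_elim
    case (elim n)
    have "real (num_colored_prime_patterns n) / (real n * 2 ^ n)
        \<le> gamma_C' * (real n + 2) * 2 ^ n / (real n * 2 ^ n)"
      by (intro divide_right_mono num_patterns_upper) simp
    also have "\<dots> = gamma_C' + 2 * gamma_C' / real n"
      using elim(2) by (simp add: field_simps)
    finally show ?case
      using elim(1) by linarith
  qed
qed

theorem theorem4p5:
  shows "(\<lambda>n. real (num_colored_prime_patterns n)) \<sim>[at_top] (\<lambda>n. gamma_C' * real n * 2 ^ n)
    \<and> (\<lambda>t. real t * (juggling_q t)\<^sup>2) summable_on {1..}
    \<and> gamma_C' = 1 / 8 * (\<Sum>\<^sub>\<infinity>t\<in>{1..}. real t *
         (\<Prod>i = 2..t. (real i - 1) / (2 ^ i - real i - 1))\<^sup>2)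
    \<and> \<bar>gamma_C' - 0.478326\<bar> < 1 / 10 ^ 6"
proof (intro conjI)
  have "(\<lambda>n. real (num_colored_prime_patterns n) / (real n * 2 ^ n) / gamma_C') \<longlonglongrightarrow> gamma_C' / gamma_C'"
    using gamma_C'_pos by (intro tendsto_divide num_patterns_tendsto tendsto_const) simp
  then have "(\<lambda>n. real (num_colored_prime_patterns n) / (gamma_C' * real n * 2 ^ n)) \<longlonglongrightarrow> 1"
    using gamma_C'_pos by (simp add: mult_ac)
  then show "(\<lambda>n. real (num_colored_prime_patterns n)) \<sim>[at_top] (\<lambda>n. gamma_C' * real n * 2 ^ n)"
    by (rule asymp_equivI')
  show "gamma_term summable_on {1..}"
    using has_sum_gamma_term by (rule has_sum_imp_summable)
  \<comment> \<open>The factor 1/4 is the square of the leading 1/2 in \<open>juggling_q\<close>;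
    with the outer 1/2 it becomes 1/8.\<close>
  have "gamma_term t = 1 / 4 * (real t * (\<Prod>i = 2..t. (real i - 1) / (2 ^ i - real i - 1))\<^sup>2)" for t
    by (simp add: juggling_q_def power_mult_distrib power2_eq_square)
  then have "(\<Sum>\<^sub>\<infinity>t\<in>{1..}. gamma_term t) =
      1 / 4 * (\<Sum>\<^sub>\<infinity>t\<in>{1..}. real t * (\<Prod>i = 2..t. (real i - 1) / (2 ^ i - real i - 1))\<^sup>2)"
    by (simp only: infsum_cmult_right')
  then show "gamma_C' = 1 / 8 * (\<Sum>\<^sub>\<infinity>t\<in>{1..}. real t *
         (\<Prod>i = 2..t. (real i - 1) / (2 ^ i - real i - 1))\<^sup>2)"
    unfolding gamma_C'_def by simp
qed (rule gamma_C'_bounds)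

end
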